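(* Let $P$ be a probability measure on $(\Omega,\mathcal F)$ under which the coordinate process $X$ is a nonnegative local martingale with $P(X_0=1)=1$. If $P(T_a\wedge T_0<\mathfrak T)=1$ for some $a\in(1,\infty)$, then $$\mathrm{d}P(\,\cdot\,|\,T_a\le T_0)=X_{T_a}\,\mathrm{d}P,$$ i.e. the conditional probability measure $P(\cdot|T_a\le T_0)$ on $(\Omega,\mathcal F)$ is absolutely continuous with respect to $P$ with density $X_{T_a}$.
   Context: $\Omega=C_{\mathrm{abs}}$ is the space of functions $\omega:[0,\infty)\to[0,\infty]$ that are absorbed in $0$ and in $\infty$ (once $\omega$ reaches $0$ or $\infty$ it stays there) and that are continuous on $[0,T_\infty(\omega))$, where $T_\infty(\omega)$ is the first hitting time of $\{\infty\}$. $X$ is the coordinate process, $X_t(\omega)=\omega(t)$, and $X_\infty:=\sqrt{\limsup_{t\uparrow\infty}X_t\,\liminf_{t\uparrow\infty}X_t}$ with the convention $\infty\cdot 0:=1$. The filtration is $\mathcal F_t=\sigma(X_s:s\le t)$ and $\mathcal F=\bigvee_{t\ge0}\mathcal F_t$; local martingales are with respect to this filtration. For $a\in[0,\infty]$, $T_a=\inf\{t\in[0,\infty]:X_t=a\}$ (the time $t=\infty$ is allowed), with $\inf\emptyset:=\mathfrak T$, where $\mathfrak T$ is an extra symbol ("time beyond infinity") and the order is extended to $[0,\infty]\cup\{\mathfrak T\}$ by $t<\mathfrak T$ for all $t\in[0,\infty]$. For a stopping time $\tau$, $X^\tau$ is the process $X$ stopped at $\tau$, and $X_\tau$ denotes $X^\tau_\infty$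 (so $X_\tau=X_\infty$ on $\{\tau\ge\infty\}$). *)

theory Defs
  imports "HOL-Probability.Probability" "HOL-Library.Lattice_Constructions"
begin

section \<open>The coordinate process\<close>

definition ennsqrt :: "ennreal \<Rightarrow> ennreal" where
  "ennsqrt x = (if x = \<infinity> then \<infinity> else ennreal (sqrt (enn2real x)))"

text \<open>The first case is the convention \<open>\<infinity> \<cdot> 0 = 1\<close>; the library has \<open>\<infinity> * 0 = 0\<close> on \<^typ>\<open>ennreal\<close>.\<close>

definition X_infinity :: "(real \<Rightarrow> ennreal) \<Rightarrow> ennreal" where
  "X_infinity \<omega> =
    (if Limsup at_top \<omega> = \<infinity> \<and> Liminf at_top \<omega> = 0 then ennsqrt 1
     else ennsqrt (Limsup at_top \<omega> * Liminf at_top \<omega>))"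

text \<open>The coordinate process on the closed time axis \<open>[0, \<infinity>]\<close>.\<close>

definition X :: "ennreal \<Rightarrow> (real \<Rightarrow> ennreal) \<Rightarrow> ennreal" where
  "X t \<omega> = (if t = \<infinity> then X_infinity \<omega> else \<omega> (enn2real t))"

text \<open>Random times live in \<open>[0, \<infinity>]\<close> with one further element \<^const>\<open>top.Top\<close> on top,
  the time beyond infinity, which is the value of an infimum over the empty set.\<close>

definition hit :: "ennreal \<Rightarrow> (real \<Rightarrow> ennreal) \<Rightarrow> ennreal top" where
  "hit a \<omega> = (if \<exists>t. X t \<omega> = a then top.Value (INF t \<in> {t. X t \<omega> = a}. t) else top.Top)"

section \<open>The path space\<close>

text \<open>Paths are functions on \<open>[0, \<infinity>)\<close>, hence extensional. The last condition says that a path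
  that reaches \<open>\<infinity>\<close> in finite time is at \<open>\<infinity>\<close> at its first hitting time, i.e. that the infimum
  is attained. Without it the value at that single time would be arbitrary, and the hitting times
  of finite levels would not be measurable with respect to the coordinates.\<close>

definition C_abs :: "(real \<Rightarrow> ennreal) set" where
  "C_abs = {\<omega> \<in> {0..} \<rightarrow>\<^sub>E UNIV.
     (\<forall>s t. 0 \<le> s \<and> s \<le> t \<and> \<omega> s \<in> {0, \<infinity>} \<longrightarrow> \<omega> t = \<omega> s) \<and>
     continuous_on {t. 0 \<le> t \<and> top.Value (ennreal t) < hit \<infinity> \<omega>} \<omega> \<and>
     (\<forall>t\<ge>0. hit \<infinity> \<omega> = top.Value (ennreal t) \<longrightarrow> \<omega> t = \<infinity>)}"

text \<open>At \<open>t = \<infinity>\<close> this is the \<open>\<sigma>\<close>-algebra generated by all \<open>X\<^sub>s\<close> with \<open>s < \<infinity>\<close>.\<close>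

definition nat_filtration :: "ennreal \<Rightarrow> (real \<Rightarrow> ennreal) measure" where
  "nat_filtration t = sigma C_abs
     {X s -` B \<inter> C_abs | s B. s \<le> t \<and> s < \<infinity> \<and> B \<in> sets borel}"

definition path_algebra :: "(real \<Rightarrow> ennreal) measure" where
  "path_algebra = sigma C_abs (\<Union>t \<in> {..<\<infinity>}. sets (nat_filtration t))"

section \<open>Stopping and nonnegative local martingales\<close>

text \<open>The minimum below is never \<^const>\<open>top.Top\<close>, so the case expression is exhaustive.\<close>

definition stopped :: "(ennreal \<Rightarrow> 'w \<Rightarrow> ennreal) \<Rightarrow> ('w \<Rightarrow> ennreal top) \<Rightarrow> ennreal \<Rightarrow> 'w \<Rightarrow> ennreal" where
  "stopped Y \<tau> t \<omega> = (case min (top.Value t) (\<tau> \<omega>) of top.Value s \<Rightarrow> Y s \<omega>)"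

definition value_at :: "(ennreal \<Rightarrow> 'w \<Rightarrow> ennreal) \<Rightarrow> ('w \<Rightarrow> ennreal top) \<Rightarrow> 'w \<Rightarrow> ennreal" where
  "value_at Y \<tau> \<omega> = stopped Y \<tau> \<infinity> \<omega>"

text \<open>Martingales and local martingales on \<open>[0, \<infinity>)\<close>: the value of a process at time \<open>\<infinity>\<close> plays no
  role in the following two definitions. In \<open>nn_local_martingale\<close> the initial value is not
  subtracted, so it is integrable.\<close>

definition nn_martingale ::
  "'w measure \<Rightarrow> (ennreal \<Rightarrow> 'w measure) \<Rightarrow> (ennreal \<Rightarrow> 'w \<Rightarrow> ennreal) \<Rightarrow> bool" where
  "nn_martingale M F Y \<longleftrightarrow>
     (\<forall>t<\<infinity>. Y t \<in> borel_measurable (F t) \<and> (\<integral>\<^sup>+ \<omega>. Y t \<omega> \<partial>M) < \<infinity>) \<and>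
     (\<forall>s t. s \<le> t \<and> t < \<infinity> \<longrightarrow> (AE \<omega> in M. nn_cond_exp M (F s) (Y t) \<omega> = Y s \<omega>))"

definition nn_local_martingale ::
  "'w measure \<Rightarrow> (ennreal \<Rightarrow> 'w measure) \<Rightarrow> (ennreal \<Rightarrow> 'w \<Rightarrow> ennreal) \<Rightarrow> bool" where
  "nn_local_martingale M F Y \<longleftrightarrow>
     (\<exists>\<tau> :: nat \<Rightarrow> 'w \<Rightarrow> ennreal.
        (\<forall>n. stopping_time F (\<tau> n)) \<and>
        (\<forall>\<omega> \<in> space M. incseq (\<lambda>n. \<tau> n \<omega>)) \<and>
        (AE \<omega> in M. (\<lambda>n. \<tau> n \<omega>) \<longlonglongrightarrow> \<infinity>) \<and>
        (\<forall>n. nn_martingale M F (stopped Y (\<lambda>\<omega>. top.Value (\<tau> n \<omega>)))))"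

end

theory Submission
  imports Defs
begin

text \<open>
  Let \<open>A\<close> be the event \<open>hit a \<omega> \<le> hit 0 \<omega>\<close>. Since almost surely \<open>a\<close> or \<open>0\<close> is reached at the latest at
  time \<open>\<infinity>\<close>, and \<open>0\<close> is absorbing, the variable \<open>value_at X (hit a)\<close> is almost surely \<open>a\<close> on \<open>A\<close> and \<open>0\<close>
  elsewhere. Both measures in question are therefore multiples of the restriction of \<open>P\<close> to \<open>A\<close>, and
  the claim amounts to \<open>a * P A = 1\<close>, that is, to the statement that \<open>X\<close> stopped at the hitting time of \<open>a\<close>
  has mean \<open>1\<close> at time \<open>\<infinity>\<close>.

  Almost all paths are finite, hence continuous (\<open>AE_finite_paths\<close>). For \<open>l \<ge> 0\<close> let \<open>T l\<close> be the first
  time outside \<open>(l, a)\<close>, and let \<open>\<sigma> n\<close> be the minimum of \<open>n\<close> and the \<open>n\<close>-th localizing time. Optional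
  sampling (\<open>exit_sampling\<close>) shows that \<open>X\<close> at time \<open>min (\<sigma> n) (T l)\<close> has mean \<open>1\<close>, and this variable is at
  most \<open>a\<close>. It remains to let \<open>n\<close> tend to \<open>\<infinity>\<close>.

  \<^item> For \<open>l = 0\<close> the limit inferior is at least \<open>a\<close> on \<open>A\<close> (\<open>liminf_stopped_ge\<close>), and Fatou's lemma gives
    \<open>a * P A \<le> 1\<close>.

  \<^item> For \<open>l > 0\<close> the limit superior is at most \<open>a\<close> on \<open>A\<close> and at most \<open>l\<close> off \<open>A\<close> (\<open>limsup_stopped_le\<close>), and
    the reverse Fatou lemma gives \<open>1 \<le> a * P A + l\<close>.

  The positive barrier \<open>l\<close> takes the place of the martingale convergence theorem. Off \<open>A\<close> the
  assumption yields \<open>X_infinity \<omega> = 0\<close>, which says only that the limit inferior of the path is \<open>0\<close>; but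
  this is enough to know that the path gets below \<open>l\<close> at a finite time.

  Optional sampling in continuous time is obtained from discrete time on finer and finer grids. The
  sampled values need not be bounded by \<open>a\<close>, because the path may move between the exit and the
  next grid time. What replaces a bound is that the discrete identity holds on every event
  \<open>Z \<in> C\<close> determined by the sampled value \<open>Z\<close>; this is a form of uniform integrability
  (\<open>nn_integral_sampled_limit\<close>).
\<close>

section \<open>Paths\<close>

lemma C_abs_absorbed:
  assumes "\<omega> \<in> C_abs" "0 \<le> s" "s \<le> t" "\<omega> s = 0 \<or> \<omega> s = \<infinity>"
  shows "\<omega> t = \<omega> s"
proof -
  have "\<forall>s t. 0 \<le> s \<and> s \<le> t \<and> \<omega> s \<in> {0, \<infinity>} \<longrightarrow> \<omega> t = \<omega> s"
    using assms(1) unfolding C_abs_def mem_Collect_eq by blast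
  with assms show ?thesis by blast
qed

lemma X_real [simp]: "0 \<le> t \<Longrightarrow> X (ennreal t) \<omega> = \<omega> t"
  by (simp add: X_def)

lemma X_fin: "s < \<infinity> \<Longrightarrow> X s = (\<lambda>\<omega>. \<omega> (enn2real s))"
  by (auto simp: X_def fun_eq_iff)

text \<open>Absorption in \<open>\<infinity>\<close> turns the continuity before the explosion time, which the definition of the path
  space grants, into continuity up to any time at which the path is finite.\<close>
lemma before_explosion:
  assumes "\<omega> \<in> C_abs" "0 \<le> t" "\<omega> t < \<infinity>"
  shows "top.Value (ennreal t) < hit \<infinity> \<omega>"
proof (rule ccontr)
  assume "\<not> ?thesis"
  then obtain v where v: "hit \<infinity> \<omega> = top.Value v" "v \<le> ennreal t"
    by (cases "hit \<infinity> \<omega>") auto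
  then obtain u where u: "v = ennreal u" "0 \<le> u"
    by (cases v) (auto simp: top_unique)
  with v assms(2) have "u \<le> t" by simp
  moreover have "\<omega> u = \<infinity>"
    using assms(1) v u by (auto simp: C_abs_def)
  ultimately show False
    using C_abs_absorbed[OF assms(1) u(2), of t] assms(3) by auto
qed

lemma path_continuous_on:
  assumes "\<omega> \<in> C_abs" "0 \<le> t" "\<omega> t < \<infinity>"
  shows "continuous_on {0..t} \<omega>"
proof (rule continuous_on_subset)
  show "continuous_on {t. 0 \<le> t \<and> top.Value (ennreal t) < hit \<infinity> \<omega>} \<omega>"
    using assms(1) by (simp only: C_abs_def mem_Collect_eq)
  show "{0..t} \<subseteq> {t. 0 \<le> t \<and> top.Value (ennreal t) < hit \<infinity> \<omega>}"
  proof
    fix u assume u: "u \<in> {0..t}"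
    then have "\<omega> u < \<infinity>"
      using C_abs_absorbed[OF assms(1), of u t] assms(3) u by (cases "\<omega> u = \<infinity>") (auto simp: less_top)
    then show "u \<in> {t. 0 \<le> t \<and> top.Value (ennreal t) < hit \<infinity> \<omega>}"
      using before_explosion[OF assms(1), of u] u by auto
  qed
qed

lemma finite_slightly_later:
  assumes "\<omega> \<in> C_abs" "0 \<le> t" "\<omega> t < \<infinity>"
  shows "\<exists>u>t. \<omega> u < \<infinity>"
proof -
  have "\<exists>u>t. top.Value (ennreal u) < hit \<infinity> \<omega>"
  proof (cases "hit \<infinity> \<omega>")
    case (Value v)
    with before_explosion[OF assms] have "ennreal t < v" by simp
    from dense[OF this] obtain w where w: "ennreal t < w" "w < v" by auto
    then obtain u where "w = ennreal u" "0 \<le> u" by (cases w) (auto simp: top_unique)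
    with w Value assms show ?thesis by (auto intro!: exI[of _ u] simp: ennreal_less_iff)
  next
    case Top then show ?thesis by (auto intro: exI[of _ "t+1"])
  qed
  then obtain u where u: "u > t" "top.Value (ennreal u) < hit \<infinity> \<omega>" by auto
  have "\<omega> u \<noteq> \<infinity>"
  proof
    assume "\<omega> u = \<infinity>"
    then have "X (ennreal u) \<omega> = \<infinity>" using u assms by simp
    then have "hit \<infinity> \<omega> \<le> top.Value (ennreal u)"
      by (auto simp: hit_def intro: Inf_lower)
    with u show False by simp
  qed
  with u show ?thesis by (auto simp: less_top)
qed

text \<open>The jump to \<open>\<infinity>\<close> is the only possible discontinuity, and the path stays there.\<close>

lemma path_right_continuous:
  assumes "\<omega> \<in> C_abs" "0 \<le> t"
  shows "(\<omega> \<longlongrightarrow> \<omega> t) (at_right t)"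
proof (cases "\<omega> t < \<infinity>")
  case True
  from finite_slightly_later[OF assms True] obtain u where u: "u > t" "\<omega> u < \<infinity>" by auto
  have "continuous_on {0..u} \<omega>"
    using u assms by (intro path_continuous_on) auto
  then have "continuous_on {t..u} \<omega>"
    by (rule continuous_on_subset) (use assms in auto)
  then show ?thesis
    using u by (simp add: continuous_on_Icc_at_rightD)
next
  case False
  then have "\<omega> t = \<infinity>" by (simp add: not_less top_unique)
  then have "\<omega> u = \<omega> t" if "t < u" for u
    using C_abs_absorbed[OF assms, of u] that by simp
  then have "eventually (\<lambda>u. \<omega> u = \<omega> t) (at_right t)"
    by (rule eventually_mono[OF eventually_at_right_less])
  then show ?thesis by (simp add: tendsto_eventually)
qed

text \<open>By right-continuity the values at rational times determine all strict inequalities that a path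
  satisfies; the measurability of \<open>X_infinity\<close> and of exits and hits rests on this.\<close>
lemma rational_after:
  fixes y :: real
  assumes "\<omega> \<in> C_abs" "0 \<le> t" "t < y" "open U" "\<omega> t \<in> U"
  shows "\<exists>q\<in>\<rat>. t < q \<and> q < y \<and> \<omega> q \<in> U"
proof -
  have "eventually (\<lambda>u. \<omega> u \<in> U) (at_right t)"
    using path_right_continuous[OF assms(1,2)] assms(4,5) by (rule topological_tendstoD)
  then obtain b where b: "b > t" "\<And>u. t < u \<Longrightarrow> u < b \<Longrightarrow> \<omega> u \<in> U"
    by (auto simp: eventually_at_right_field)
  then obtain q where "q \<in> \<rat>" "t < q" "q < min b y"
    using Rats_dense_in_real[of t "min b y"] assms by auto
  with b show ?thesis by auto
qed

text \<open>Adding the right end point compensates for the approximation from the right only.\<close>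

definition rational_times :: "real \<Rightarrow> real set" where
  "rational_times s = insert s (\<rat> \<inter> {0..s})"

text \<open>The supremum over a compact interval is attained, so a strict bound on the path is a strict
  bound on a countable supremum.\<close>
lemma path_below_iff:
  assumes "\<omega> \<in> C_abs" "0 \<le> s" "\<omega> s < \<infinity>"
  shows "(\<forall>u\<in>{0..s}. \<omega> u < b) \<longleftrightarrow> (SUP q\<in>rational_times s. \<omega> q) < b"
proof
  assume *: "\<forall>u\<in>{0..s}. \<omega> u < b"
  from continuous_attains_sup[OF _ _ path_continuous_on[OF assms]] assms(2)
  obtain u where u: "u \<in> {0..s}" "\<forall>v\<in>{0..s}. \<omega> v \<le> \<omega> u" by auto
  have "(SUP q\<in>rational_times s. \<omega> q) \<le> \<omega> u"
    using u assms by (intro SUP_least) (auto simp: rational_times_def)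
  with * u show "(SUP q\<in>rational_times s. \<omega> q) < b" by (meson le_less_trans)
next
  assume *: "(SUP q\<in>rational_times s. \<omega> q) < b" (is "?S < b")
  have "\<omega> u \<le> ?S" if u: "u \<in> {0..s}" for u
  proof (rule ccontr)
    assume "\<not> ?thesis"
    then have c: "\<omega> u \<in> {?S<..}" by auto
    have "\<exists>q\<in>rational_times s. \<omega> q \<in> {?S<..}"
    proof (cases "u = s")
      case False
      with rational_after[OF assms(1) _ _ _ c, of s] u show ?thesis
        by (force simp: rational_times_def)
    qed (use c in \<open>auto simp: rational_times_def\<close>)
    then obtain q where "q \<in> rational_times s" "?S < \<omega> q" by auto
    moreover from this(1) have "\<omega> q \<le> ?S" by (rule SUP_upper)
    ultimately show False by simp
  qed
  with * show "\<forall>u\<in>{0..s}. \<omega> u < b" by (meson le_less_trans)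
qed

lemma path_above_iff:
  assumes "\<omega> \<in> C_abs" "0 \<le> s" "\<omega> s < \<infinity>"
  shows "(\<forall>u\<in>{0..s}. b < \<omega> u) \<longleftrightarrow> b < (INF q\<in>rational_times s. \<omega> q)"
proof
  assume *: "\<forall>u\<in>{0..s}. b < \<omega> u"
  from continuous_attains_inf[OF _ _ path_continuous_on[OF assms]] assms(2)
  obtain u where u: "u \<in> {0..s}" "\<forall>v\<in>{0..s}. \<omega> u \<le> \<omega> v" by auto
  have "\<omega> u \<le> (INF q\<in>rational_times s. \<omega> q)"
    using u assms by (intro INF_greatest) (auto simp: rational_times_def)
  with * u show "b < (INF q\<in>rational_times s. \<omega> q)" by (meson less_le_trans)
next
  assume *: "b < (INF q\<in>rational_times s. \<omega> q)" (is "b < ?S")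
  have "?S \<le> \<omega> u" if u: "u \<in> {0..s}" for u
  proof (rule ccontr)
    assume "\<not> ?thesis"
    then have c: "\<omega> u \<in> {..<?S}" by auto
    have "\<exists>q\<in>rational_times s. \<omega> q \<in> {..<?S}"
    proof (cases "u = s")
      case False
      with rational_after[OF assms(1) _ _ _ c, of s] u show ?thesis
        by (force simp: rational_times_def)
    qed (use c in \<open>auto simp: rational_times_def\<close>)
    then obtain q where "q \<in> rational_times s" "\<omega> q < ?S" by auto
    moreover from this(1) have "?S \<le> \<omega> q" by (rule INF_lower)
    ultimately show False by simp
  qed
  with * show "\<forall>u\<in>{0..s}. b < \<omega> u" by (meson less_le_trans)
qed

lemma Limsup_path:
  assumes "\<omega> \<in> C_abs"
  shows "Limsup at_top \<omega> = (INF n::nat. SUP q\<in>\<rat> \<inter> {real n..}. \<omega> q)" (is "_ = ?R")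
proof (rule antisym)
  show "Limsup at_top \<omega> \<le> ?R"
  proof (rule INF_greatest)
    fix n :: nat
    let ?S = "SUP q\<in>\<rat> \<inter> {real n..}. \<omega> q"
    have "\<omega> t \<le> ?S" if t: "t \<ge> real n" for t
    proof (rule ccontr)
      assume "\<not> ?thesis"
      then have c: "\<omega> t \<in> {?S<..}" by auto
      from rational_after[OF assms _ _ _ c, of "t+1"] t obtain q
        where q: "q \<in> \<rat>" "t < q" "?S < \<omega> q" by auto
      moreover have "\<omega> q \<le> ?S" using q t by (intro SUP_upper) auto
      ultimately show False by simp
    qed
    then have "eventually (\<lambda>t. \<omega> t \<le> ?S) at_top"
      by (rule eventually_mono[OF eventually_ge_at_top[of "real n"]])
    then show "Limsup at_top \<omega> \<le> ?S" by (rule Limsup_bounded)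
  qed
  show "?R \<le> Limsup at_top \<omega>"
    unfolding Limsup_def
  proof (rule INF_greatest)
    fix Q assume "Q \<in> {P. eventually P (at_top :: real filter)}"
    then obtain N where N: "\<And>t. t \<ge> N \<Longrightarrow> Q t" by (auto simp: eventually_at_top_linorder)
    obtain n where "N \<le> real n" using real_arch_simple by blast
    with N show "?R \<le> (SUP t\<in>Collect Q. \<omega> t)"
      by (intro INF_lower2[of n] SUP_subset_mono) auto
  qed
qed

lemma Liminf_path:
  assumes "\<omega> \<in> C_abs"
  shows "Liminf at_top \<omega> = (SUP n::nat. INF q\<in>\<rat> \<inter> {real n..}. \<omega> q)" (is "_ = ?R")
proof (rule antisym)
  show "?R \<le> Liminf at_top \<omega>"
  proof (rule SUP_least)
    fix n :: nat
    let ?S = "INF q\<in>\<rat> \<inter> {real n..}. \<omega> q"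
    have "?S \<le> \<omega> t" if t: "t \<ge> real n" for t
    proof (rule ccontr)
      assume "\<not> ?thesis"
      then have c: "\<omega> t \<in> {..<?S}" by auto
      from rational_after[OF assms _ _ _ c, of "t+1"] t obtain q
        where q: "q \<in> \<rat>" "t < q" "\<omega> q < ?S" by auto
      moreover have "?S \<le> \<omega> q" using q t by (intro INF_lower) auto
      ultimately show False by simp
    qed
    then have "eventually (\<lambda>t. ?S \<le> \<omega> t) at_top"
      by (rule eventually_mono[OF eventually_ge_at_top[of "real n"]])
    then show "?S \<le> Liminf at_top \<omega>" by (rule Liminf_bounded)
  qed
  show "Liminf at_top \<omega> \<le> ?R"
    unfolding Liminf_def
  proof (rule SUP_least)
    fix Q assume "Q \<in> {P. eventually P (at_top :: real filter)}"
    then obtain N where N: "\<And>t. t \<ge> N \<Longrightarrow> Q t" by (auto simp: eventually_at_top_linorder)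
    obtain n where "N \<le> real n" using real_arch_simple by blast
    with N show "(INF t\<in>Collect Q. \<omega> t) \<le> ?R"
      by (intro SUP_upper2[of n] INF_superset_mono) auto
  qed
qed

section \<open>Hitting times\<close>

lemma ennsqrt_eq_0_iff [simp]: "ennsqrt x = 0 \<longleftrightarrow> x = 0"
  by (cases x) (auto simp: ennsqrt_def ennreal_eq_0_iff)

lemma ennsqrt_eqD: "ennsqrt x = a \<Longrightarrow> a < \<infinity> \<Longrightarrow> x = a * a"
  by (cases x) (auto simp: ennsqrt_def ennreal_mult[symmetric])

lemma X_infinity_absorbed:
  assumes "\<omega> \<in> C_abs" "0 \<le> t" "\<omega> t = 0"
  shows "X_infinity \<omega> = 0"
proof -
  have "eventually (\<lambda>u. \<omega> u = 0) at_top"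
    using C_abs_absorbed[OF assms(1,2)] assms(3)
    by (intro eventually_mono[OF eventually_ge_at_top[of t]]) simp
  then have "Limsup at_top \<omega> = Limsup (at_top::real filter) (\<lambda>_. 0::ennreal)" by (rule Limsup_eq)
  then have "Limsup at_top \<omega> = 0" by (simp add: Limsup_const)
  then show ?thesis by (simp add: X_infinity_def)
qed

lemma ex_X_eq_iff: "(\<exists>t. X t \<omega> = a) \<longleftrightarrow> (\<exists>t\<ge>0. \<omega> t = a) \<or> X_infinity \<omega> = a"
proof
  assume "\<exists>t. X t \<omega> = a"
  then obtain t where "X t \<omega> = a" by auto
  then show "(\<exists>t\<ge>0. \<omega> t = a) \<or> X_infinity \<omega> = a"
    by (cases t) (auto simp: X_def)
next
  assume "(\<exists>t\<ge>0. \<omega> t = a) \<or> X_infinity \<omega> = a"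
  then show "\<exists>t. X t \<omega> = a"
    using X_real[of _ \<omega>] by (metis X_def)
qed

lemma hit_eq_Top_iff: "hit a \<omega> = top.Top \<longleftrightarrow> \<not> (\<exists>t\<ge>0. \<omega> t = a) \<and> X_infinity \<omega> \<noteq> a"
  using ex_X_eq_iff[of \<omega> a] by (auto simp: hit_def)

text \<open>Absorption makes every visit to \<open>0\<close> later than all visits to \<open>a\<close>. Only the case that neither level
  is ever reached, where both times are \<open>top.Top\<close>, has to be added.\<close>
lemma hit_le_hit_0_iff:
  assumes "\<omega> \<in> C_abs" "a \<noteq> 0"
  shows "hit a \<omega> \<le> hit 0 \<omega> \<longleftrightarrow>
    (\<exists>t\<ge>0. \<omega> t = a) \<or> X_infinity \<omega> = a \<or> (\<forall>t\<ge>0. \<omega> t \<noteq> 0) \<and> X_infinity \<omega> \<noteq> 0"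
proof (cases "(\<exists>t\<ge>0. \<omega> t = a) \<or> X_infinity \<omega> = a")
  case True
  then have ex: "\<exists>t. X t \<omega> = a" using ex_X_eq_iff[of \<omega> a] by simp
  have "t \<le> s" if t: "X t \<omega> = a" and s: "X s \<omega> = 0" for t s
  proof (rule ccontr)
    assume "\<not> ?thesis"
    then have "s < t" by simp
    then obtain s' where s': "s = ennreal s'" "0 \<le> s'" by (cases s) (auto simp: top_unique)
    then have z: "\<omega> s' = 0" using s by simp
    show False
    proof (cases t)
      case (real t')
      then have "s' \<le> t'" using \<open>s < t\<close> s' by (simp add: ennreal_less_iff)
      then have "\<omega> t' = 0" using C_abs_absorbed[OF assms(1) s'(2), of t'] z by simp
      with t real assms(2) show False by simp
    next
      case top
      then show False using t X_infinity_absorbed[OF assms(1) s'(2) z] assms(2) by (simp add: X_def)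
    qed
  qed
  then have "X t \<omega> = 0 \<Longrightarrow> (INF s\<in>{s. X s \<omega> = a}. s) \<le> t" for t
  proof -
    assume "X t \<omega> = 0"
    moreover obtain r where "X r \<omega> = a" using ex by auto
    ultimately show "(INF s\<in>{s. X s \<omega> = a}. s) \<le> t"
      using \<open>\<And>t s. X t \<omega> = a \<Longrightarrow> X s \<omega> = 0 \<Longrightarrow> t \<le> s\<close> by (intro INF_lower2[of r]) auto
  qed
  then have "(INF s\<in>{s. X s \<omega> = a}. s) \<le> (INF s\<in>{s. X s \<omega> = 0}. s)"
    by (intro INF_greatest) auto
  with ex have "hit a \<omega> \<le> hit 0 \<omega>" by (simp add: hit_def)
  with True show ?thesis by auto
next
  case False
  then have "hit a \<omega> = top.Top" by (simp add: hit_eq_Top_iff)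
  then have "hit a \<omega> \<le> hit 0 \<omega> \<longleftrightarrow> hit 0 \<omega> = top.Top"
    using less_eq_top_is_Top by auto
  with False show ?thesis using hit_eq_Top_iff[of 0 \<omega>] by auto
qed

text \<open>Finite levels are hit before the explosion, where the path is continuous; so the infimum
  that defines the hitting time is attained.\<close>

lemma value_at_hit:
  assumes "\<omega> \<in> C_abs" "a < \<infinity>"
  shows "value_at X (hit a) \<omega> = (if \<exists>t\<ge>0. \<omega> t = a then a else X_infinity \<omega>)"
proof (cases "\<exists>t\<ge>0. \<omega> t = a")
  case True
  then obtain t where t: "0 \<le> t" "\<omega> t = a" by auto
  have "continuous_on {0..t} \<omega>" using t assms by (intro path_continuous_on) auto
  then have "closed ({0..t} \<inter> \<omega> -` {a})"
    by (intro continuous_closed_preimage) auto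
  then have "compact ({0..t} \<inter> \<omega> -` {a})"
    by (metis Int_assoc Int_absorb compact_Icc compact_Int_closed)
  moreover have "t \<in> {0..t} \<inter> \<omega> -` {a}" using t by simp
  ultimately have "\<exists>u\<in>{0..t} \<inter> \<omega> -` {a}. \<forall>v\<in>{0..t} \<inter> \<omega> -` {a}. u \<le> v"
    by (intro compact_attains_inf) auto
  then obtain u
    where u: "u \<in> {0..t}" "\<omega> u = a" "\<And>v. v \<in> {0..t} \<Longrightarrow> \<omega> v = a \<Longrightarrow> u \<le> v" by auto
  have "(INF s\<in>{s. X s \<omega> = a}. s) = ennreal u"
  proof (rule antisym)
    show "(INF s\<in>{s. X s \<omega> = a}. s) \<le> ennreal u" using u by (intro INF_lower) auto
    show "ennreal u \<le> (INF s\<in>{s. X s \<omega> = a}. s)"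
    proof (rule INF_greatest)
      fix s assume "s \<in> {s. X s \<omega> = a}"
      then show "ennreal u \<le> s"
        using u(1) u(3)[of "enn2real s"]
        by (cases s; cases "enn2real s \<le> t") (auto simp: ennreal_le_iff)
    qed
  qed
  moreover have "\<exists>s. X s \<omega> = a" using True ex_X_eq_iff by metis
  ultimately have "hit a \<omega> = top.Value (ennreal u)" by (simp add: hit_def)
  then show ?thesis using True u by (simp add: value_at_def stopped_def min_def top_unique)
next
  case False
  have *: "X t \<omega> = a \<longleftrightarrow> t = \<infinity> \<and> X_infinity \<omega> = a" for t
    using False by (cases t) (auto simp: X_def)
  have "hit a \<omega> = top.Top \<or> hit a \<omega> = top.Value \<infinity>"
    unfolding hit_def * by (auto simp: top_unique)
  with False show ?thesis by (auto simp: value_at_def stopped_def min_def X_def)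
qed

section \<open>Measurability\<close>

lemma space_nat_filtration [simp]: "space (nat_filtration t) = C_abs"
  by (simp add: nat_filtration_def space_measure_of_conv)

lemma space_path_algebra [simp]: "space path_algebra = C_abs"
  by (simp add: path_algebra_def space_measure_of_conv)

lemma sets_nat_filtration:
  "sets (nat_filtration t) =
    sigma_sets C_abs {X s -` B \<inter> C_abs | s B. s \<le> t \<and> s < \<infinity> \<and> B \<in> sets borel}"
  unfolding nat_filtration_def by (intro sets_measure_of) auto

lemma sets_nat_filtration_mono: "s \<le> t \<Longrightarrow> sets (nat_filtration s) \<subseteq> sets (nat_filtration t)"
  unfolding sets_nat_filtration by (intro sigma_sets_mono') (auto intro: order_trans)

lemma subalgebra_path_algebra:
  assumes "t < \<infinity>"
  shows "subalgebra path_algebra (nat_filtration t)"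
proof -
  have "(\<Union>t \<in> {..<\<infinity>}. sets (nat_filtration t)) \<subseteq> Pow C_abs"
    using sets.sets_into_space by fastforce
  then have "sets path_algebra = sigma_sets C_abs (\<Union>t \<in> {..<\<infinity>}. sets (nat_filtration t))"
    unfolding path_algebra_def by (rule sets_measure_of)
  with assms show ?thesis by (auto simp: subalgebra_def)
qed

lemma coordinate_measurable_nat_filtration:
  assumes "0 \<le> s" "s \<le> t"
  shows "(\<lambda>\<omega>. \<omega> s) \<in> borel_measurable (nat_filtration (ennreal t))"
proof (rule measurableI)
  fix B :: "ennreal set" assume "B \<in> sets borel"
  moreover have "(\<lambda>\<omega>. \<omega> s) -` B \<inter> C_abs = X (ennreal s) -` B \<inter> C_abs" using assms by auto
  ultimately show "(\<lambda>\<omega>. \<omega> s) -` B \<inter> space (nat_filtration (ennreal t)) \<in> sets (nat_filtration (ennreal t))"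
    using assms unfolding sets_nat_filtration
    by (intro sigma_sets.Basic) (auto intro!: exI[of _ "ennreal s"] exI[of _ B] simp: ennreal_leI)
qed simp

lemma coordinate_measurable [measurable]:
  assumes "0 \<le> s"
  shows "(\<lambda>\<omega>. \<omega> s) \<in> borel_measurable path_algebra"
  using measurable_from_subalg[OF subalgebra_path_algebra coordinate_measurable_nat_filtration[of s s]]
    assms by simp

lemma X_infinity_measurable [measurable]: "X_infinity \<in> borel_measurable path_algebra"
proof -
  have "(\<lambda>\<omega>. INF n::nat. SUP q\<in>\<rat> \<inter> {real n..}. \<omega> q) \<in> borel_measurable path_algebra"
    by (intro borel_measurable_INF borel_measurable_SUP coordinate_measurable)
      (auto intro: countable_rat countable_subset)
  then have 1: "Limsup at_top \<in> borel_measurable path_algebra"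
    by (subst measurable_cong[OF Limsup_path]) auto
  have "(\<lambda>\<omega>. SUP n::nat. INF q\<in>\<rat> \<inter> {real n..}. \<omega> q) \<in> borel_measurable path_algebra"
    by (intro borel_measurable_INF borel_measurable_SUP coordinate_measurable)
      (auto intro: countable_rat countable_subset)
  then have 2: "Liminf at_top \<in> borel_measurable path_algebra"
    by (subst measurable_cong[OF Liminf_path]) auto
  have 3: "ennsqrt \<in> borel_measurable borel"
    unfolding ennsqrt_def by measurable
  note [measurable] = 1 2 3
  show ?thesis unfolding X_infinity_def by measurable
qed

text \<open>A path that is finite at time \<open>s\<close> is continuous up to \<open>s\<close>; its extreme values over
  \<open>[0, s]\<close> are then read off at countably many times.\<close>

lemma stays_below_measurable:
  assumes "0 \<le> s"
  shows "{\<omega> \<in> C_abs. \<omega> s < \<infinity> \<and> (\<forall>u\<in>{0..s}. \<omega> u < b)} \<in> sets (nat_filtration (ennreal s))"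
proof -
  have [measurable]: "(\<lambda>\<omega>. SUP q\<in>rational_times s. \<omega> q) \<in> borel_measurable (nat_filtration (ennreal s))"
    using assms
    by (intro borel_measurable_SUP coordinate_measurable_nat_filtration)
      (auto simp: rational_times_def intro: countable_rat countable_subset)
  have [measurable]: "(\<lambda>\<omega>. \<omega> s) \<in> borel_measurable (nat_filtration (ennreal s))"
    using assms by (intro coordinate_measurable_nat_filtration) auto
  have "{\<omega> \<in> C_abs. \<omega> s < \<infinity> \<and> (\<forall>u\<in>{0..s}. \<omega> u < b)} =
      {\<omega> \<in> space (nat_filtration (ennreal s)). \<omega> s < \<infinity> \<and> (SUP q\<in>rational_times s. \<omega> q) < b}"
    using path_below_iff assms by (intro Collect_cong) auto
  also have "\<dots> \<in> sets (nat_filtration (ennreal s))" by measurable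
  finally show ?thesis .
qed

lemma stays_above_measurable:
  assumes "0 \<le> s"
  shows "{\<omega> \<in> C_abs. \<omega> s < \<infinity> \<and> (\<forall>u\<in>{0..s}. b < \<omega> u)} \<in> sets (nat_filtration (ennreal s))"
proof -
  have [measurable]: "(\<lambda>\<omega>. INF q\<in>rational_times s. \<omega> q) \<in> borel_measurable (nat_filtration (ennreal s))"
    using assms
    by (intro borel_measurable_INF coordinate_measurable_nat_filtration)
      (auto simp: rational_times_def intro: countable_rat countable_subset)
  have [measurable]: "(\<lambda>\<omega>. \<omega> s) \<in> borel_measurable (nat_filtration (ennreal s))"
    using assms by (intro coordinate_measurable_nat_filtration) auto
  have "{\<omega> \<in> C_abs. \<omega> s < \<infinity> \<and> (\<forall>u\<in>{0..s}. b < \<omega> u)} =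
      {\<omega> \<in> space (nat_filtration (ennreal s)). \<omega> s < \<infinity> \<and> b < (INF q\<in>rational_times s. \<omega> q)}"
    using path_above_iff assms by (intro Collect_cong) auto
  also have "\<dots> \<in> sets (nat_filtration (ennreal s))" by measurable
  finally show ?thesis .
qed

text \<open>The interval \<open>(l, h)\<close> is open, so that for continuous paths the first time outside is attained and
  the event of having left by time \<open>s\<close> belongs to the past of \<open>s\<close>; with a closed interval
  one would have to look into the immediate future.\<close>
definition exits_by :: "ennreal \<Rightarrow> ennreal \<Rightarrow> real \<Rightarrow> (real \<Rightarrow> ennreal) \<Rightarrow> bool" where
  "exits_by l h s \<omega> \<longleftrightarrow> (\<exists>u\<in>{0..s}. \<not> (l < \<omega> u \<and> \<omega> u < h))"

lemma exits_by_measurable: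
  assumes "0 \<le> s" "s \<le> t"
  shows "{\<omega> \<in> C_abs. exits_by l h s \<omega>} \<in> sets (nat_filtration (ennreal t))"
proof -
  let ?A = "{\<omega> \<in> C_abs. \<omega> s < \<infinity> \<and> (\<forall>u\<in>{0..s}. \<omega> u < h)}"
  let ?B = "{\<omega> \<in> C_abs. \<omega> s < \<infinity> \<and> (\<forall>u\<in>{0..s}. l < \<omega> u)}"
  have "\<omega> s < \<infinity>" if "\<omega> s < h" for \<omega> :: "real \<Rightarrow> ennreal"
    using that by (simp add: less_top order.strict_trans2)
  then have "{\<omega> \<in> C_abs. exits_by l h s \<omega>} = space (nat_filtration (ennreal s)) - ?A \<inter> ?B"
    using assms by (auto simp: exits_by_def)
  also have "\<dots> \<in> sets (nat_filtration (ennreal s))"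
    using assms by (intro sets.Diff sets.Int stays_below_measurable stays_above_measurable sets.top)
  finally show ?thesis
    using sets_nat_filtration_mono[OF ennreal_leI[OF assms(2)]] by auto
qed

text \<open>Up to a time \<open>r\<close> at which the path is finite it is continuous, and misses \<open>a\<close> exactly if it stays
  below \<open>a\<close> or stays above \<open>a\<close>. The restriction to finite \<open>\<omega> r\<close> discards the paths that approach \<open>a\<close> just
  before they jump to \<open>\<infinity>\<close>.\<close>
lemma hits_measurable:
  assumes "a < \<infinity>"
  shows "{\<omega> \<in> C_abs. \<exists>t\<ge>0. \<omega> t = a} \<in> sets path_algebra"
proof -
  let ?A = "\<lambda>r. {\<omega> \<in> C_abs. \<omega> r < \<infinity> \<and> (\<forall>u\<in>{0..r}. \<omega> u < a)}"
  let ?B = "\<lambda>r. {\<omega> \<in> C_abs. \<omega> r < \<infinity> \<and> (\<forall>u\<in>{0..r}. a < \<omega> u)}"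
  have "(\<exists>t\<ge>0. \<omega> t = a) \<longleftrightarrow> (\<exists>r\<in>\<rat> \<inter> {0..}. \<omega> r < \<infinity> \<and> \<omega> \<notin> ?A r \<and> \<omega> \<notin> ?B r)"
    if \<omega>: "\<omega> \<in> C_abs" for \<omega>
  proof
    assume "\<exists>t\<ge>0. \<omega> t = a"
    then obtain t where t: "0 \<le> t" "\<omega> t = a" by auto
    from rational_after[OF \<omega> t(1), of "t+1" "{..<\<infinity>}"] t assms obtain r
      where "r \<in> \<rat>" "t < r" "\<omega> r < \<infinity>" by auto
    moreover have "\<not> (\<forall>u\<in>{0..r}. \<omega> u < a)" "\<not> (\<forall>u\<in>{0..r}. a < \<omega> u)"
      using t \<open>t < r\<close> by (auto intro: bexI[of _ t])
    ultimately show "\<exists>r\<in>\<rat> \<inter> {0..}. \<omega> r < \<infinity> \<and> \<omega> \<notin> ?A r \<and> \<omega> \<notin> ?B r"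
      using t by (intro bexI[of _ r]) auto
  next
    assume "\<exists>r\<in>\<rat> \<inter> {0..}. \<omega> r < \<infinity> \<and> \<omega> \<notin> ?A r \<and> \<omega> \<notin> ?B r"
    then obtain r where r: "0 \<le> r" "\<omega> r < \<infinity>" "\<omega> \<notin> ?A r" "\<omega> \<notin> ?B r" by auto
    then have "\<exists>u\<in>{0..r}. a \<le> \<omega> u" "\<exists>v\<in>{0..r}. \<omega> v \<le> a"
      using \<omega> by (simp_all add: not_less)
    then obtain u v where uv: "u \<in> {0..r}" "v \<in> {0..r}" "a \<le> \<omega> u" "\<omega> v \<le> a" by blast
    have "connected (\<omega> ` {0..r})"
      using path_continuous_on[OF \<omega> r(1,2)] by (intro connected_continuous_image) auto
    then have "a \<in> \<omega> ` {0..r}"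
      by (rule connectedD_interval[OF _ imageI[OF uv(2)] imageI[OF uv(1)] uv(4,3)])
    then show "\<exists>t\<ge>0. \<omega> t = a" by auto
  qed
  then have "{\<omega> \<in> C_abs. \<exists>t\<ge>0. \<omega> t = a} =
      (\<Union>r\<in>\<rat> \<inter> {0..}. {\<omega> \<in> space path_algebra. \<omega> r < \<infinity>} - ?A r - ?B r)"
    by (intro set_eqI) (simp, blast)
  also have "\<dots> \<in> sets path_algebra"
  proof (rule sets.countable_UN'')
    show "countable (\<rat> \<inter> {0::real..})" by (auto intro: countable_rat countable_subset)
    fix r :: real assume r: "r \<in> \<rat> \<inter> {0..}"
    have "sets (nat_filtration (ennreal r)) \<subseteq> sets path_algebra"
      using subalgebra_path_algebra[of "ennreal r"] by (simp add: subalgebra_def)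
    then have "?A r \<in> sets path_algebra" "?B r \<in> sets path_algebra"
      using r stays_below_measurable[of r a] stays_above_measurable[of r a] by auto
    moreover have "{\<omega> \<in> space path_algebra. \<omega> r < \<infinity>} \<in> sets path_algebra"
      using r by (intro borel_measurable_less coordinate_measurable borel_measurable_const) auto
    ultimately show "{\<omega> \<in> space path_algebra. \<omega> r < \<infinity>} - ?A r - ?B r \<in> sets path_algebra"
      by blast
  qed
  finally show ?thesis .
qed

lemma value_at_hit_measurable:
  assumes "a < \<infinity>"
  shows "value_at X (hit a) \<in> borel_measurable path_algebra"
proof -
  have [measurable]: "Measurable.pred path_algebra (\<lambda>\<omega>. \<exists>t\<ge>0. \<omega> t = a)"
    using hits_measurable[OF assms] by (simp add: pred_def)
  have "(\<lambda>\<omega>. if \<exists>t\<ge>0. \<omega> t = a then a else X_infinity \<omega>) \<in> borel_measurable path_algebra"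
    by measurable
  then show ?thesis
    using assms by (subst measurable_cong[OF value_at_hit]) auto
qed

lemma hit_le_hit_0_measurable:
  assumes "a \<noteq> 0" "a < \<infinity>"
  shows "{\<omega> \<in> C_abs. hit a \<omega> \<le> hit 0 \<omega>} \<in> sets path_algebra"
proof -
  have [measurable]: "Measurable.pred path_algebra (\<lambda>\<omega>. \<exists>t\<ge>0. \<omega> t = a)"
    "Measurable.pred path_algebra (\<lambda>\<omega>. \<exists>t\<ge>0. \<omega> t = 0)"
    using hits_measurable[of a] hits_measurable[of 0] assms by (simp_all add: pred_def)
  have "{\<omega> \<in> C_abs. hit a \<omega> \<le> hit 0 \<omega>} = {\<omega> \<in> space path_algebra.
      (\<exists>t\<ge>0. \<omega> t = a) \<or> X_infinity \<omega> = a \<or> \<not> (\<exists>t\<ge>0. \<omega> t = 0) \<and> X_infinity \<omega> \<noteq> 0}"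
    using hit_le_hit_0_iff[of _ a] assms by auto
  also have "\<dots> \<in> sets path_algebra" by measurable
  finally show ?thesis .
qed

section \<open>Optional sampling\<close>

lemma nn_martingale_set_integral:
  assumes "prob_space M" "subalgebra M (F s)" "nn_martingale M F Y" "s \<le> t" "t < \<infinity>"
    and "B \<in> sets (F s)" "Y t \<in> borel_measurable M"
  shows "(\<integral>\<^sup>+\<omega>. Y t \<omega> * indicator B \<omega> \<partial>M) = (\<integral>\<^sup>+\<omega>. Y s \<omega> * indicator B \<omega> \<partial>M)"
proof -
  interpret prob_space M by fact
  interpret finite_measure_subalgebra M "F s"
    by unfold_locales (fact assms)
  have "AE \<omega> in M. nn_cond_exp M (F s) (Y t) \<omega> = Y s \<omega>"
    using assms unfolding nn_martingale_def by blast
  then have "(\<integral>\<^sup>+\<omega>. Y s \<omega> * indicator B \<omega> \<partial>M) = (\<integral>\<^sup>+\<omega>. indicator B \<omega> * nn_cond_exp M (F s) (Y t) \<omega> \<partial>M)"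
    by (intro nn_integral_cong_AE) (auto simp: mult.commute)
  also have "\<dots> = (\<integral>\<^sup>+\<omega>. indicator B \<omega> * Y t \<omega> \<partial>M)"
    using assms by (intro nn_cond_exp_intg) auto
  finally show ?thesis by (simp add: mult.commute)
qed

text \<open>On \<open>{J = i}\<close>, an event of the past of \<open>i\<close>, the martingale property replaces \<open>Y i\<close> by \<open>Y K\<close>. The
  indicator of \<open>C\<close> can be carried along because \<open>Y i \<in> C\<close> belongs to the past of \<open>i\<close> too; these extra
  indicators are what controls large values of the sampled process later on.\<close>
lemma optional_sampling_finite:
  fixes J :: "'w \<Rightarrow> nat" and Y :: "nat \<Rightarrow> 'w \<Rightarrow> ennreal"
  assumes sub: "\<And>i. i \<le> K \<Longrightarrow> subalgebra M (G i)"
    and Y: "\<And>i. i \<le> K \<Longrightarrow> Y i \<in> borel_measurable (G i)"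
    and mart: "\<And>i B. i \<le> K \<Longrightarrow> B \<in> sets (G i) \<Longrightarrow>
      (\<integral>\<^sup>+\<omega>. Y K \<omega> * indicator B \<omega> \<partial>M) = (\<integral>\<^sup>+\<omega>. Y i \<omega> * indicator B \<omega> \<partial>M)"
    and J: "\<And>i. i \<le> K \<Longrightarrow> {\<omega> \<in> space M. J \<omega> = i} \<in> sets (G i)"
      "\<And>\<omega>. \<omega> \<in> space M \<Longrightarrow> J \<omega> \<le> K"
  shows "(\<lambda>\<omega>. Y (J \<omega>) \<omega>) \<in> borel_measurable M" (is ?meas)
    and "C \<in> sets borel \<Longrightarrow> (\<integral>\<^sup>+\<omega>. Y (J \<omega>) \<omega> * indicator C (Y (J \<omega>) \<omega>) \<partial>M) =
      (\<integral>\<^sup>+\<omega>. Y K \<omega> * indicator C (Y (J \<omega>) \<omega>) \<partial>M)" (is "_ \<Longrightarrow> ?eq")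
proof -
  have YM: "Y i \<in> borel_measurable M" if "i \<le> K" for i
    using measurable_from_subalg[OF sub Y] that by blast
  have sets: "sets (G i) \<subseteq> sets M" "space (G i) = space M" if "i \<le> K" for i
    using sub[OF that] by (auto simp: subalgebra_def)
  have JM: "{\<omega> \<in> space M. J \<omega> = i} \<in> sets M" if "i \<le> K" for i
    using J(1)[OF that] sets(1)[OF that] by blast
  have "(\<lambda>\<omega>. \<Sum>i\<le>K. Y i \<omega> * indicator {\<omega> \<in> space M. J \<omega> = i} \<omega>) \<in> borel_measurable M"
    using YM JM by (intro borel_measurable_sum borel_measurable_times_ennreal borel_measurable_indicator) auto
  moreover have "(\<Sum>i\<le>K. Y i \<omega> * indicator {\<omega> \<in> space M. J \<omega> = i} \<omega>) = Y (J \<omega>) \<omega>"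
    if "\<omega> \<in> space M" for \<omega>
  proof -
    have "(\<Sum>i\<le>K. Y i \<omega> * indicator {\<omega> \<in> space M. J \<omega> = i} \<omega>) = (\<Sum>i\<in>{J \<omega>}. Y i \<omega> * indicator {\<omega> \<in> space M. J \<omega> = i} \<omega>)"
      using J(2) that by (intro sum.mono_neutral_right) auto
    with that show ?thesis by simp
  qed
  ultimately show ?meas by (simp cong: measurable_cong)
  assume C: "C \<in> sets borel"
  define B where "B i = {\<omega> \<in> space M. J \<omega> = i} \<inter> (Y i -` C \<inter> space M)" for i
  have B: "B i \<in> sets (G i)" if "i \<le> K" for i
    using J(1)[OF that] measurable_sets[OF Y[OF that] C] sets[OF that] by (auto simp: B_def)
  then have BM: "B i \<in> sets M" if "i \<le> K" for i using that sets by blast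
  have *: "V * indicator C (Y (J \<omega>) \<omega>) = (\<Sum>i\<le>K. V * indicator (B i) \<omega>)"
    if "\<omega> \<in> space M" for \<omega> and V :: ennreal
  proof -
    have "(\<Sum>i\<le>K. V * indicator (B i) \<omega>) = (\<Sum>i\<in>{J \<omega>}. V * indicator (B i) \<omega>)"
      using J(2) that by (intro sum.mono_neutral_right) (auto simp: B_def)
    with that show ?thesis by (simp add: B_def indicator_def)
  qed
  have "(\<integral>\<^sup>+\<omega>. Y (J \<omega>) \<omega> * indicator C (Y (J \<omega>) \<omega>) \<partial>M) = (\<integral>\<^sup>+\<omega>. (\<Sum>i\<le>K. Y (J \<omega>) \<omega> * indicator (B i) \<omega>) \<partial>M)"
    using * by (intro nn_integral_cong) auto
  also have "\<dots> = (\<integral>\<^sup>+\<omega>. (\<Sum>i\<le>K. Y i \<omega> * indicator (B i) \<omega>) \<partial>M)"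
    by (intro nn_integral_cong sum.cong) (auto simp: B_def indicator_def)
  also have "\<dots> = (\<Sum>i\<le>K. \<integral>\<^sup>+\<omega>. Y i \<omega> * indicator (B i) \<omega> \<partial>M)"
    using YM BM by (intro nn_integral_sum) auto
  also have "\<dots> = (\<Sum>i\<le>K. \<integral>\<^sup>+\<omega>. Y K \<omega> * indicator (B i) \<omega> \<partial>M)"
    using mart B by (intro sum.cong) auto
  also have "\<dots> = (\<integral>\<^sup>+\<omega>. (\<Sum>i\<le>K. Y K \<omega> * indicator (B i) \<omega>) \<partial>M)"
    using YM BM by (intro nn_integral_sum[symmetric]) auto
  also have "\<dots> = (\<integral>\<^sup>+\<omega>. Y K \<omega> * indicator C (Y (J \<omega>) \<omega>) \<partial>M)"
    using * by (intro nn_integral_cong) auto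
  finally show ?eq .
qed

text \<open>The sampled variables \<open>Z k\<close> need not have an integrable majorant. But the identity for \<open>C = {..a + 1}\<close>
  compares the integral of a truncation of \<open>Z k\<close>, which is bounded, with an integral of \<open>V\<close> over an
  event that fills the whole space in the limit. Dominated convergence applies to both sides.\<close>
lemma nn_integral_sampled_limit:
  fixes Z :: "nat \<Rightarrow> 'w \<Rightarrow> ennreal" and a :: ennreal
  assumes "finite_measure M"
    and [measurable]: "\<And>k. Z k \<in> borel_measurable M" "V \<in> borel_measurable M" "W \<in> borel_measurable M"
    and V: "(\<integral>\<^sup>+\<omega>. V \<omega> \<partial>M) < \<infinity>"
    and eq: "\<And>k C. C \<in> sets borel \<Longrightarrow>
      (\<integral>\<^sup>+\<omega>. Z k \<omega> * indicator C (Z k \<omega>) \<partial>M) = (\<integral>\<^sup>+\<omega>. V \<omega> * indicator C (Z k \<omega>) \<partial>M)"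
    and lim: "AE \<omega> in M. (\<lambda>k. Z k \<omega>) \<longlonglongrightarrow> W \<omega>"
    and le: "AE \<omega> in M. W \<omega> \<le> a" and a: "a < \<infinity>"
  shows "(\<integral>\<^sup>+\<omega>. W \<omega> \<partial>M) = (\<integral>\<^sup>+\<omega>. V \<omega> \<partial>M)"
proof -
  interpret finite_measure M by fact
  let ?C = "{..a + 1}"
  have aa: "a < a + 1" using a by (cases a) (auto simp: ennreal_plus[symmetric] ennreal_less_iff simp del: ennreal_plus)
  have ev: "AE \<omega> in M. eventually (\<lambda>k. indicator ?C (Z k \<omega>) = (1::ennreal)) sequentially"
    using lim le
  proof eventually_elim
    case (elim \<omega>)
    then have "eventually (\<lambda>k. Z k \<omega> < a + 1) sequentially"
      by (intro order_tendstoD(2)[OF elim(1)] le_less_trans[OF elim(2) aa])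
    then show ?case by (rule eventually_mono) auto
  qed
  have "(\<lambda>k. \<integral>\<^sup>+\<omega>. Z k \<omega> * indicator ?C (Z k \<omega>) \<partial>M) \<longlonglongrightarrow> (\<integral>\<^sup>+\<omega>. W \<omega> \<partial>M)"
  proof (rule nn_integral_dominated_convergence[where w = "\<lambda>_. a + 1"])
    show "AE \<omega> in M. (\<lambda>k. Z k \<omega> * indicator ?C (Z k \<omega>)) \<longlonglongrightarrow> W \<omega>"
      using ev lim
    proof eventually_elim
      case (elim \<omega>)
      show ?case
        by (rule Lim_transform_eventually[OF elim(2)])
          (use elim(1) in \<open>auto elim!: eventually_mono\<close>)
    qed
    show "(\<integral>\<^sup>+\<omega>. a + 1 \<partial>M) < \<infinity>"
      using a by (simp add: ennreal_mult_eq_top_iff emeasure_eq_measure less_top[symmetric])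
  qed (auto split: split_indicator)
  moreover have "(\<lambda>k. \<integral>\<^sup>+\<omega>. V \<omega> * indicator ?C (Z k \<omega>) \<partial>M) \<longlonglongrightarrow> (\<integral>\<^sup>+\<omega>. V \<omega> \<partial>M)"
  proof (rule nn_integral_dominated_convergence[where w = V])
    show "AE \<omega> in M. (\<lambda>k. V \<omega> * indicator ?C (Z k \<omega>)) \<longlonglongrightarrow> V \<omega>"
      using ev
    proof eventually_elim
      case (elim \<omega>)
      show ?case
        by (rule Lim_transform_eventually[OF tendsto_const])
          (use elim in \<open>auto elim!: eventually_mono\<close>)
    qed
  qed (use V in \<open>auto split: split_indicator\<close>)
  ultimately show ?thesis
    using eq[of ?C] LIMSEQ_unique by auto
qed

section \<open>Exit from an interval\<close>

definition exit_time :: "ennreal \<Rightarrow> ennreal \<Rightarrow> (real \<Rightarrow> ennreal) \<Rightarrow> ennreal" where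
  "exit_time l h \<omega> = (INF u\<in>{u. 0 \<le> u \<and> \<not> (l < \<omega> u \<and> \<omega> u < h)}. ennreal u)"

lemma inside_before_exit:
  "0 \<le> u \<Longrightarrow> ennreal u < exit_time l h \<omega> \<Longrightarrow> l < \<omega> u \<and> \<omega> u < h"
  unfolding exit_time_def by (rule ccontr) (auto dest!: less_INF_D)

text \<open>If the path is still inside at time \<open>s\<close>, right-continuity keeps it inside for a little longer.\<close>
lemma exits_by_iff:
  assumes "\<omega> \<in> C_abs" "0 \<le> s"
  shows "exits_by l h s \<omega> \<longleftrightarrow> exit_time l h \<omega> \<le> ennreal s"
proof
  assume "exits_by l h s \<omega>"
  then obtain u where "u \<in> {0..s}" "\<not> (l < \<omega> u \<and> \<omega> u < h)" by (auto simp: exits_by_def)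
  then show "exit_time l h \<omega> \<le> ennreal s"
    unfolding exit_time_def by (intro INF_lower2[of u]) (auto simp: ennreal_leI)
next
  assume le: "exit_time l h \<omega> \<le> ennreal s"
  show "exits_by l h s \<omega>"
  proof (rule ccontr)
    assume "\<not> exits_by l h s \<omega>"
    then have in': "l < \<omega> u \<and> \<omega> u < h" if "u \<in> {0..s}" for u
      using that by (auto simp: exits_by_def)
    then have "\<omega> s \<in> {l<..<h}" using assms by auto
    then have "eventually (\<lambda>u. \<omega> u \<in> {l<..<h}) (at_right s)"
      using path_right_continuous[OF assms] by (intro topological_tendstoD) auto
    then obtain b where b: "b > s" "\<And>u. s < u \<Longrightarrow> u < b \<Longrightarrow> l < \<omega> u \<and> \<omega> u < h"
      by (auto simp: eventually_at_right_field)
    have "ennreal b \<le> exit_time l h \<omega>"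
      unfolding exit_time_def
    proof (rule INF_greatest)
      fix u assume "u \<in> {u. 0 \<le> u \<and> \<not> (l < \<omega> u \<and> \<omega> u < h)}"
      then have "\<not> u < b" using b(2)[of u] in'[of u] by (cases "u \<le> s") auto
      then show "ennreal b \<le> ennreal u" by (intro ennreal_leI) auto
    qed
    moreover have "ennreal s < ennreal b" using assms b by (simp add: ennreal_less_iff)
    ultimately show False using le by (meson leD le_less_trans less_le_trans)
  qed
qed

lemma outside_at_exit:
  assumes "\<omega> \<in> C_abs" "0 \<le> t" "exit_time l h \<omega> = ennreal t"
  shows "\<not> (l < \<omega> t \<and> \<omega> t < h)"
proof -
  have "exits_by l h t \<omega>" using exits_by_iff[OF assms(1,2)] assms(3) by simp
  then obtain u where u: "u \<in> {0..t}" "\<not> (l < \<omega> u \<and> \<omega> u < h)" by (auto simp: exits_by_def)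
  then have "\<not> ennreal u < ennreal t" using inside_before_exit[of u l h \<omega>] assms(3) by auto
  with u have "u = t" by (auto simp: ennreal_less_iff)
  with u show ?thesis by simp
qed

lemma finite_path_continuous:
  assumes "\<omega> \<in> C_abs" "\<forall>t\<ge>0. \<omega> t < \<infinity>"
  shows "continuous_on {0..} \<omega>"
  unfolding continuous_on_eq_continuous_within
proof
  fix t :: real assume "t \<in> {0..}"
  moreover have "continuous_on {0..t + 1} \<omega>"
    using assms \<open>t \<in> {0..}\<close> by (intro path_continuous_on) auto
  ultimately have "continuous (at t within {0..t + 1}) \<omega>"
    by (auto simp: continuous_on_eq_continuous_within)
  moreover have "at t within {0..t + 1} = at t within {0..}"
    by (rule at_within_nhd[of t "{..<t + 1}"]) auto
  ultimately show "continuous (at t within {0..}) \<omega>" by simp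
qed

text \<open>A continuous path that starts below \<open>h\<close> cannot jump over \<open>h\<close>.\<close>
lemma value_until_exit_le:
  assumes "\<omega> \<in> C_abs" "\<forall>t\<ge>0. \<omega> t < \<infinity>" "\<omega> 0 \<le> h" "0 \<le> t" "ennreal t \<le> exit_time l h \<omega>"
  shows "\<omega> t \<le> h"
proof (cases "t = 0")
  case False
  have "\<omega> u \<le> h" if "0 \<le> u" "u < t" for u
    using inside_before_exit[of u l h \<omega>] that assms(5) order.strict_trans2[of "ennreal u" "ennreal t"]
    by (auto simp: ennreal_less_iff)
  then have "eventually (\<lambda>u. \<omega> u \<le> h) (at_left t)"
    using False assms(4) by (auto simp: eventually_at_left_field intro!: exI[of _ 0])
  moreover have "continuous_on {0..t} \<omega>"
    using assms by (intro path_continuous_on) auto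
  then have "(\<omega> \<longlongrightarrow> \<omega> t) (at_left t)"
    using False assms(4) by (intro continuous_on_Icc_at_leftD) auto
  ultimately show ?thesis
    by (intro tendsto_upperbound[of \<omega> "\<omega> t" "at_left t" h]) auto
qed (use assms in simp)

lemma stopped_Value [simp]: "stopped Y (\<lambda>\<omega>. top.Value (\<tau> \<omega>)) t \<omega> = Y (min t (\<tau> \<omega>)) \<omega>"
  by (simp add: stopped_def min_def)

lemma X_min_real:
  assumes "0 \<le> s" "s \<le> real n"
  shows "X (min (ennreal s) v) \<omega> = \<omega> (min s (enn2real (min (of_nat n) v)))"
proof (cases v)
  case (real r)
  then have "min (of_nat n) v = ennreal (min (real n) r)"
    by (simp add: min_def ennreal_of_nat_eq_real_of_nat)
  moreover have "min (ennreal s) v = ennreal (min s r)" using assms real by (simp add: min_def)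
  ultimately show ?thesis using assms real by (simp add: min_def)
next
  case top
  then have "min (of_nat n) v = ennreal (real n)" by (simp add: min_def top_unique ennreal_of_nat_eq_real_of_nat)
  moreover have "min (ennreal s) v = ennreal s" using top by (simp add: min_def)
  ultimately show ?thesis using assms by (simp add: min_def)
qed

text \<open>The first grid time after the exit overestimates the exit time, cut off at \<open>n\<close>, by at most one
  mesh size.\<close>
lemma exit_grid_time:
  fixes h :: real and a b :: ennreal and \<omega> :: "real \<Rightarrow> ennreal" and n K :: nat
  assumes "\<omega> \<in> C_abs" "0 < h" "real n = real K * h"
  defines "j \<equiv> LEAST i. i = K \<or> exits_by a b (real i * h) \<omega>"
  defines "r \<equiv> enn2real (min (of_nat n) (exit_time a b \<omega>))"
  shows "r \<le> real j * h" and "real j * h \<le> r + h" and "j \<le> K"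
proof -
  have r: "ennreal r = min (of_nat n) (exit_time a b \<omega>)"
    unfolding r_def by (intro ennreal_enn2real) (rule min.strict_coboundedI1, simp add: ennreal_of_nat_eq_real_of_nat)
  have r0: "0 \<le> r" by (simp add: r_def)
  show jK: "j \<le> K" unfolding j_def by (rule Least_le) simp
  have "j = K \<or> exits_by a b (real j * h) \<omega>"
    unfolding j_def by (rule LeastI[of _ K]) simp
  then have "min (of_nat n) (exit_time a b \<omega>) \<le> ennreal (real j * h)"
  proof
    assume "j = K"
    then have "of_nat n = ennreal (real j * h)" using assms(3) by (simp add: ennreal_of_nat_eq_real_of_nat)
    then show ?thesis by simp
  next
    assume "exits_by a b (real j * h) \<omega>"
    then show ?thesis using exits_by_iff[OF assms(1)] assms(2) by (simp add: min.coboundedI2)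
  qed
  then have "ennreal r \<le> ennreal (real j * h)" by (simp only: r)
  then show "r \<le> real j * h" using assms(2) by (simp add: ennreal_le_iff)
  show "real j * h \<le> r + h"
  proof (cases j)
    case (Suc i)
    then have "\<not> (i = K \<or> exits_by a b (real i * h) \<omega>)"
      using not_less_Least[of i "\<lambda>i. i = K \<or> exits_by a b (real i * h) \<omega>"] by (simp add: j_def)
    then have "ennreal (real i * h) \<le> exit_time a b \<omega>"
      using exits_by_iff[OF assms(1), of "real i * h"] assms(2) by (simp add: not_le less_imp_le)
    moreover have "real i * h \<le> real n" using assms(2,3) Suc jK by simp
    then have "ennreal (real i * h) \<le> of_nat n" by (simp add: ennreal_of_nat_eq_real_of_nat ennreal_leI)
    ultimately have "ennreal (real i * h) \<le> ennreal r" using r by simp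
    then have "real i * h \<le> r" using r0 by simp
    with Suc show ?thesis by (simp add: algebra_simps)
  qed (use assms(2) r0 in simp)
qed

lemma stopped_mean:
  assumes "prob_space P" and sets_P: "sets P = sets path_algebra"
    and mart: "nn_martingale P nat_filtration (stopped X (\<lambda>\<omega>. top.Value (\<tau> \<omega>)))"
    and start: "AE \<omega> in P. \<omega> 0 = 1" and t: "t < \<infinity>"
  shows "stopped X (\<lambda>\<omega>. top.Value (\<tau> \<omega>)) t \<in> borel_measurable P"
    and "(\<integral>\<^sup>+\<omega>. stopped X (\<lambda>\<omega>. top.Value (\<tau> \<omega>)) t \<omega> \<partial>P) = 1"
proof -
  interpret prob_space P by fact
  let ?S = "stopped X (\<lambda>\<omega>. top.Value (\<tau> \<omega>))"
  have space_P: "space P = C_abs" using sets_eq_imp_space_eq[OF sets_P] by simp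
  have sub: "subalgebra P (nat_filtration t)" if "t < \<infinity>" for t
    using subalgebra_path_algebra[OF that] sets_P space_P by (simp add: subalgebra_def)
  show St: "?S t \<in> borel_measurable P"
    using mart t by (intro measurable_from_subalg[OF sub]) (auto simp: nn_martingale_def)
  have "(\<integral>\<^sup>+\<omega>. ?S t \<omega> \<partial>P) = (\<integral>\<^sup>+\<omega>. ?S t \<omega> * indicator C_abs \<omega> \<partial>P)"
    by (intro nn_integral_cong) (simp add: space_P)
  also have "\<dots> = (\<integral>\<^sup>+\<omega>. ?S 0 \<omega> * indicator C_abs \<omega> \<partial>P)"
    using sets.top[of "nat_filtration 0"] t
    by (intro nn_martingale_set_integral[OF prob_space_axioms sub mart _ _ _ St]) auto
  also have "\<dots> = (\<integral>\<^sup>+\<omega>. 1 \<partial>P)"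
    using start AE_space by (intro nn_integral_cong_AE) (auto simp: X_def space_P)
  finally show "(\<integral>\<^sup>+\<omega>. ?S t \<omega> \<partial>P) = 1" by (simp add: emeasure_space_1)
qed

text \<open>Optional sampling at the exit time: it holds at the grid times that approximate the exit time
  from above, and the path continuity identifies the limit of the sampled values, which is at most \<open>a\<close>.
  The approximations themselves may exceed \<open>a\<close>. \<open>W\<close> is the limit of the sampled values, hence measurable.\<close>
lemma exit_sampling:
  assumes "prob_space P" and sets_P: "sets P = sets path_algebra"
    and mart: "nn_martingale P nat_filtration (stopped X (\<lambda>\<omega>. top.Value (\<tau> \<omega>)))"
    and start: "AE \<omega> in P. \<omega> 0 = 1" and fin: "AE \<omega> in P. \<forall>t\<ge>0. \<omega> t < \<infinity>"
    and a: "1 < a" "a < \<infinity>" and n: "0 < n"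
  shows "\<exists>W\<in>borel_measurable P. (\<integral>\<^sup>+\<omega>. W \<omega> \<partial>P) = 1 \<and>
    (AE \<omega> in P. W \<omega> = X (min (min (of_nat n) (\<tau> \<omega>)) (exit_time l a \<omega>)) \<omega> \<and> W \<omega> \<le> a)"
proof -
  interpret prob_space P by fact
  have space_P: "space P = C_abs" using sets_eq_imp_space_eq[OF sets_P] by simp
  have sub: "subalgebra P (nat_filtration t)" if "t < \<infinity>" for t
    using subalgebra_path_algebra[OF that] sets_P space_P by (simp add: subalgebra_def)
  let ?S = "stopped X (\<lambda>\<omega>. top.Value (\<tau> \<omega>))"
  have Smeas: "?S t \<in> borel_measurable (nat_filtration t)" if "t < \<infinity>" for t
    using mart that by (simp add: nn_martingale_def)
  note SmeasP = stopped_mean(1)[OF assms(1-4)]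
  define V where "V = ?S (of_nat n)"
  have V: "V \<in> borel_measurable P" unfolding V_def by (intro SmeasP) (simp add: less_top[symmetric])
  have V1: "(\<integral>\<^sup>+\<omega>. V \<omega> \<partial>P) = 1"
    unfolding V_def by (intro stopped_mean(2)[OF assms(1-4)]) (simp add: less_top[symmetric])
  define h where "h k = real n / real (Suc k)" for k
  have h: "0 < h k" "real n = real (Suc k) * h k" for k
    using n by (auto simp: h_def)
  define J where "J k \<omega> = (LEAST i. i = Suc k \<or> exits_by l a (real i * h k) \<omega>)" for k \<omega>
  define Z where "Z k \<omega> = ?S (ennreal (real (J k \<omega>) * h k)) \<omega>" for k \<omega>
  have Z: "Z k \<in> borel_measurable P"
    "\<And>C. C \<in> sets borel \<Longrightarrow> (\<integral>\<^sup>+\<omega>. Z k \<omega> * indicator C (Z k \<omega>) \<partial>P) = (\<integral>\<^sup>+\<omega>. V \<omega> * indicator C (Z k \<omega>) \<partial>P)" for k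
  proof -
    \<comment> \<open>For fixed \<open>k\<close> this is optional sampling in discrete time, on the grid with mesh \<open>h k\<close>.\<close>
    let ?G = "\<lambda>i. nat_filtration (ennreal (real i * h k))"
    let ?Y = "\<lambda>i. ?S (ennreal (real i * h k))"
    have mono: "ennreal (real i * h k) \<le> ennreal (real j * h k)" if "i \<le> j" for i j
      using that h(1)[of k] by (intro ennreal_leI) auto
    have sub': "subalgebra P (?G i)" for i by (intro sub) simp
    have Y: "?Y i \<in> borel_measurable (?G i)" for i by (intro Smeas) simp
    have VK: "V = ?Y (Suc k)"
      using h(2)[of k] by (simp only: V_def ennreal_of_nat_eq_real_of_nat)
    have mart': "(\<integral>\<^sup>+\<omega>. ?Y (Suc k) \<omega> * indicator B \<omega> \<partial>P) = (\<integral>\<^sup>+\<omega>. ?Y i \<omega> * indicator B \<omega> \<partial>P)"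
      if "i \<le> Suc k" "B \<in> sets (?G i)" for i B
      using that(2)
      by (intro nn_martingale_set_integral[OF prob_space_axioms sub' mart mono[OF that(1)]] SmeasP) auto
    have JG: "{\<omega> \<in> space P. J k \<omega> = i} \<in> sets (?G i)" if "i \<le> Suc k" for i
    proof -
      have ex: "{\<omega> \<in> C_abs. exits_by l a (real j * h k) \<omega>} \<in> sets (?G i)" if "j \<le> i" for j
        using that h(1)[of k] by (intro exits_by_measurable) auto
      have "{\<omega> \<in> space P. J k \<omega> = i} = {\<omega> \<in> space (?G i). (i = Suc k \<or> exits_by l a (real i * h k) \<omega>) \<and>
          (\<forall>j\<in>{..<i}. \<not> exits_by l a (real j * h k) \<omega>)}"
      proof -
        have Least_iff: "(LEAST i. Q i) = i \<longleftrightarrow> Q i \<and> (\<forall>j\<in>{..<i}. \<not> Q j)" if "Q (Suc k)" for Q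
          using that by (metis LeastI Least_equality lessThan_iff not_less not_less_Least)
        have "J k \<omega> = i \<longleftrightarrow> (i = Suc k \<or> exits_by l a (real i * h k) \<omega>) \<and>
          (\<forall>j\<in>{..<i}. \<not> (j = Suc k \<or> exits_by l a (real j * h k) \<omega>))" for \<omega>
          unfolding J_def by (rule Least_iff) simp
        with \<open>i \<le> Suc k\<close> show ?thesis by (auto simp: space_P)
      qed
      also have "\<dots> \<in> sets (?G i)"
        by (intro sets.sets_Collect sets.sets_Collect_finite_All) (use ex in auto)
      finally show ?thesis .
    qed
    have JK: "J k \<omega> \<le> Suc k" for \<omega> unfolding J_def by (rule Least_le) simp
    show "Z k \<in> borel_measurable P"
      unfolding Z_def by (rule optional_sampling_finite(1)[of "Suc k" P ?G ?Y, OF sub' Y mart' JG JK])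
    show "(\<integral>\<^sup>+\<omega>. Z k \<omega> * indicator C (Z k \<omega>) \<partial>P) = (\<integral>\<^sup>+\<omega>. V \<omega> * indicator C (Z k \<omega>) \<partial>P)"
      if "C \<in> sets borel" for C
      unfolding Z_def VK by (rule optional_sampling_finite(2)[of "Suc k" P ?G ?Y, OF sub' Y mart' JG JK that])
  qed
  define W where "W \<omega> = liminf (\<lambda>k. Z k \<omega>)" for \<omega>
  have W: "W \<in> borel_measurable P" unfolding W_def using Z(1) by measurable
  let ?L = "\<lambda>\<omega>. X (min (min (of_nat n) (\<tau> \<omega>)) (exit_time l a \<omega>)) \<omega>"
  have lim: "(\<lambda>k. Z k \<omega>) \<longlonglongrightarrow> ?L \<omega>" "?L \<omega> \<le> a"
    if \<omega>: "\<omega> \<in> C_abs" "\<omega> 0 = 1" "\<forall>t\<ge>0. \<omega> t < \<infinity>" for \<omega>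
  proof -
    define r where "r = enn2real (min (of_nat n) (exit_time l a \<omega>))"
    define v where "v = enn2real (min (of_nat n) (\<tau> \<omega>))"
    have nn: "0 \<le> r" "0 \<le> v" by (simp_all add: r_def v_def)
    have r: "ennreal r = min (of_nat n) (exit_time l a \<omega>)"
      unfolding r_def by (intro ennreal_enn2real) (rule min.strict_coboundedI1, simp add: ennreal_of_nat_eq_real_of_nat)
    have "ennreal r \<le> ennreal (real n)" using r by (simp add: ennreal_of_nat_eq_real_of_nat[symmetric])
    then have "r \<le> real n" by (simp add: ennreal_le_iff)
    have "min (min (of_nat n) (\<tau> \<omega>)) (exit_time l a \<omega>) = min (ennreal r) (\<tau> \<omega>)"
      unfolding r by (simp add: min.commute min.left_commute)
    then have L: "?L \<omega> = \<omega> (min r v)"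
      using X_min_real[OF nn(1) \<open>r \<le> real n\<close>, of "\<tau> \<omega>" \<omega>] by (simp add: v_def)
    have Zk: "Z k \<omega> = \<omega> (min (real (J k \<omega>) * h k) v)" for k
    proof -
      have "real (J k \<omega>) * h k \<le> real (Suc k) * h k"
        using exit_grid_time(3)[OF \<omega>(1) h(1,2), where a = l and b = a] h(1)[of k]
        unfolding J_def by (intro mult_right_mono of_nat_mono) auto
      then have "real (J k \<omega>) * h k \<le> real n" using h(2) by simp
      then show ?thesis
        unfolding Z_def v_def using h(1)[of k] by (simp add: X_min_real)
    qed
    have "(\<lambda>k. real (J k \<omega>) * h k) \<longlonglongrightarrow> r"
    proof (rule tendsto_sandwich)
      show "eventually (\<lambda>k. r \<le> real (J k \<omega>) * h k) sequentially"
        using exit_grid_time(1)[OF \<omega>(1) h, where a = l and b = a] by (simp add: J_def r_def)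
      show "eventually (\<lambda>k. real (J k \<omega>) * h k \<le> r + h k) sequentially"
        using exit_grid_time(2)[OF \<omega>(1) h, where a = l and b = a] by (simp add: J_def r_def)
      have "h \<longlonglongrightarrow> 0" unfolding h_def by (rule LIMSEQ_Suc[OF lim_const_over_n])
      then show "(\<lambda>k. r + h k) \<longlonglongrightarrow> r" using tendsto_add[OF tendsto_const[of r]] by force
    qed simp
    then have "(\<lambda>k. min (real (J k \<omega>) * h k) v) \<longlonglongrightarrow> min r v"
      by (intro tendsto_min tendsto_const)
    then show "(\<lambda>k. Z k \<omega>) \<longlonglongrightarrow> ?L \<omega>"
      unfolding Zk L
      by (rule continuous_on_tendsto_compose[OF finite_path_continuous[OF \<omega>(1,3)]])
        (use nn h(1) in \<open>simp_all add: less_imp_le\<close>)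
    have "ennreal (min r v) \<le> ennreal r" by (intro ennreal_leI) simp
    also have "\<dots> \<le> exit_time l a \<omega>" using r by simp
    finally have before: "ennreal (min r v) \<le> exit_time l a \<omega>" .
    show "?L \<omega> \<le> a"
      unfolding L
      by (rule value_until_exit_le[OF \<omega>(1,3) _ _ before]) (use \<omega>(2) a nn in simp_all)
  qed
  have "AE \<omega> in P. (\<lambda>k. Z k \<omega>) \<longlonglongrightarrow> ?L \<omega> \<and> ?L \<omega> \<le> a"
    using AE_space start fin by eventually_elim (use lim space_P in auto)
  then have AE: "AE \<omega> in P. (\<lambda>k. Z k \<omega>) \<longlonglongrightarrow> W \<omega> \<and> W \<omega> = ?L \<omega> \<and> W \<omega> \<le> a"
  proof eventually_elim
    case (elim \<omega>)
    then have "W \<omega> = ?L \<omega>" unfolding W_def by (intro lim_imp_Liminf) auto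
    with elim show ?case by simp
  qed
  have "(\<integral>\<^sup>+\<omega>. W \<omega> \<partial>P) = (\<integral>\<^sup>+\<omega>. V \<omega> \<partial>P)"
    by (rule nn_integral_sampled_limit[OF finite_measure_axioms Z(1) V W _ Z(2) _ _ a(2)])
      (use AE V1 in \<open>auto elim: eventually_mono\<close>)
  with V1 W AE show ?thesis by (intro bexI[of _ W]) (auto elim: eventually_mono)
qed

section \<open>Behaviour of the stopped path at large times\<close>

text \<open>By Fatou's lemma along the localizing sequence the mean of \<open>\<omega> m\<close> is at most \<open>1\<close> for every natural
  number \<open>m\<close>, and a path that is finite at arbitrarily late times never reaches \<open>\<infinity>\<close>.\<close>
lemma AE_finite_paths:
  assumes "prob_space P" and sets_P: "sets P = sets path_algebra"
    and mart: "\<And>n::nat. nn_martingale P nat_filtration (stopped X (\<lambda>\<omega>. top.Value (\<tau> n \<omega>)))"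
    and start: "AE \<omega> in P. \<omega> 0 = 1" and \<tau>: "AE \<omega> in P. (\<lambda>n. \<tau> n \<omega>) \<longlonglongrightarrow> \<infinity>"
  shows "AE \<omega> in P. \<forall>t\<ge>0. \<omega> t < \<infinity>"
proof -
  interpret prob_space P by fact
  have space_P: "space P = C_abs" using sets_eq_imp_space_eq[OF sets_P] by simp
  let ?S = "\<lambda>n. stopped X (\<lambda>\<omega>. top.Value (\<tau> n \<omega>))"
  have "AE \<omega> in P. \<omega> (real m) < \<infinity>" for m :: nat
  proof -
    have [measurable]: "(\<lambda>\<omega>. \<omega> (real m)) \<in> borel_measurable P"
      using coordinate_measurable[of "real m"] by (simp add: measurable_cong_sets[OF sets_P refl])
    note mean = stopped_mean[OF assms(1,2) mart start, of "ennreal (real m)"]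
    have "AE \<omega> in P. \<omega> (real m) = liminf (\<lambda>n. ?S n (ennreal (real m)) \<omega>)"
      using \<tau>
    proof eventually_elim
      case (elim \<omega>)
      then have "eventually (\<lambda>n. ennreal (real m) < \<tau> n \<omega>) sequentially"
        by (rule order_tendstoD) simp
      then have "eventually (\<lambda>n. ?S n (ennreal (real m)) \<omega> = \<omega> (real m)) sequentially"
        by (rule eventually_mono) (simp add: min_def less_imp_le)
      then have "(\<lambda>n. ?S n (ennreal (real m)) \<omega>) \<longlonglongrightarrow> \<omega> (real m)" by (rule tendsto_eventually)
      then show ?case by (simp add: lim_imp_Liminf)
    qed
    then have "(\<integral>\<^sup>+\<omega>. \<omega> (real m) \<partial>P) = (\<integral>\<^sup>+\<omega>. liminf (\<lambda>n. ?S n (ennreal (real m)) \<omega>) \<partial>P)"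
      by (rule nn_integral_cong_AE)
    also have "\<dots> \<le> liminf (\<lambda>n. \<integral>\<^sup>+\<omega>. ?S n (ennreal (real m)) \<omega> \<partial>P)"
      by (intro nn_integral_liminf mean(1)) simp
    also have "\<dots> = 1" using mean(2) by (simp add: Liminf_const)
    finally have "(\<integral>\<^sup>+\<omega>. \<omega> (real m) \<partial>P) \<noteq> \<infinity>" by (auto simp: top_unique)
    then have "AE \<omega> in P. \<omega> (real m) \<noteq> \<infinity>" by (intro nn_integral_PInf_AE) auto
    then show ?thesis by (auto simp: less_top elim: eventually_mono)
  qed
  then have "AE \<omega> in P. \<forall>m. \<omega> (real m) < \<infinity>" by (simp add: AE_all_countable)
  with AE_space show ?thesis
  proof eventually_elim
    case (elim \<omega>)
    show ?case
    proof (intro allI impI)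
      fix t :: real assume t: "0 \<le> t"
      obtain m where "t \<le> real m" using real_arch_simple by blast
      moreover have "\<omega> (real m) \<noteq> \<infinity>" using elim(2) by (metis less_irrefl)
      ultimately have "\<omega> t \<noteq> \<infinity>"
        using C_abs_absorbed[of \<omega> t "real m"] elim(1) t space_P by auto
      then show "\<omega> t < \<infinity>" by (simp add: less_top)
    qed
  qed
qed

lemma hit_le_hit_0_cases:
  assumes "\<omega> \<in> C_abs" "a \<noteq> 0" "min (hit a \<omega>) (hit 0 \<omega>) < top.Top"
  shows "hit a \<omega> \<le> hit 0 \<omega> \<Longrightarrow> (\<exists>t\<ge>0. \<omega> t = a) \<or> X_infinity \<omega> = a"
    and "\<not> hit a \<omega> \<le> hit 0 \<omega> \<Longrightarrow> \<not> (\<exists>t\<ge>0. \<omega> t = a) \<and> X_infinity \<omega> = 0"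
proof -
  have "hit a \<omega> \<noteq> top.Top \<or> hit 0 \<omega> \<noteq> top.Top"
    using assms(3) by (auto simp: min_def split: if_splits)
  then show "hit a \<omega> \<le> hit 0 \<omega> \<Longrightarrow> (\<exists>t\<ge>0. \<omega> t = a) \<or> X_infinity \<omega> = a"
    using hit_eq_Top_iff[of a \<omega>] less_eq_top_is_Top[of "hit 0 \<omega>"] hit_eq_Top_iff[of 0 \<omega>]
      hit_le_hit_0_iff[OF assms(1,2)] by metis
  show "\<not> (\<exists>t\<ge>0. \<omega> t = a) \<and> X_infinity \<omega> = 0" if "\<not> hit a \<omega> \<le> hit 0 \<omega>"
    using that hit_le_hit_0_iff[OF assms(1,2)] X_infinity_absorbed[OF assms(1)] by blast
qed

lemma value_at_hit_eq_indicator: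
  assumes "\<omega> \<in> C_abs" "0 < a" "a < \<infinity>" "min (hit a \<omega>) (hit 0 \<omega>) < top.Top"
  shows "value_at X (hit a) \<omega> = (if hit a \<omega> \<le> hit 0 \<omega> then a else 0)"
  using hit_le_hit_0_cases[OF assms(1) _ assms(4)] assms(2) value_at_hit[OF assms(1,3)] by auto

lemma stopped_at_finite_exit:
  assumes "\<sigma> \<longlonglongrightarrow> \<infinity>" "exit_time l a \<omega> = ennreal t" "0 \<le> t"
  shows "(\<lambda>n. X (min (\<sigma> n) (exit_time l a \<omega>)) \<omega>) \<longlonglongrightarrow> \<omega> t"
proof -
  have "eventually (\<lambda>n. ennreal t < \<sigma> n) sequentially"
    using assms(1) by (rule order_tendstoD) simp
  then have "eventually (\<lambda>n. X (min (\<sigma> n) (exit_time l a \<omega>)) \<omega> = \<omega> t) sequentially"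
    using assms(2,3) by (auto elim!: eventually_mono simp: min_def)
  then show ?thesis by (rule tendsto_eventually)
qed

text \<open>If the exit time from \<open>(0, a)\<close> is finite, the exit takes place at \<open>a\<close>, since \<open>0\<close> is absorbing. If it is
  infinite, the path stays below \<open>a\<close> and \<open>a = X_infinity \<omega>\<close> is the geometric mean of the limits superior
  and inferior; both then equal \<open>a\<close>.\<close>
lemma liminf_stopped_ge:
  assumes \<omega>: "\<omega> \<in> C_abs"
    and a: "0 < a" "a < \<infinity>"
    and hits: "(\<exists>t\<ge>0. \<omega> t = a) \<or> X_infinity \<omega> = a"
    and \<sigma>: "\<sigma> \<longlonglongrightarrow> \<infinity>" "\<And>n. \<sigma> n < \<infinity>"
  shows "a \<le> liminf (\<lambda>n. X (min (\<sigma> n) (exit_time 0 a \<omega>)) \<omega>)"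
proof (cases "exit_time 0 a \<omega>")
  case (real t)
  have "\<omega> t \<noteq> 0"
  proof
    assume 0: "\<omega> t = 0"
    from hits show False
    proof
      assume "\<exists>s\<ge>0. \<omega> s = a"
      then obtain s where s: "0 \<le> s" "\<omega> s = a" by auto
      then have "\<not> ennreal s < ennreal t" using inside_before_exit[of s 0 a \<omega>] real by auto
      then have "t \<le> s" using s by (simp add: ennreal_less_iff)
      then show False using C_abs_absorbed[OF \<omega>, of t s] 0 s a real by auto
    next
      assume "X_infinity \<omega> = a"
      then show False using X_infinity_absorbed[OF \<omega> _ 0] real a by simp
    qed
  qed
  then have "a \<le> \<omega> t" using outside_at_exit[OF \<omega> _ real(2)] real(1) by (auto simp: not_less zero_less_iff_neq_zero)
  then show ?thesis using lim_imp_Liminf[OF _ stopped_at_finite_exit[OF \<sigma>(1) real(2,1)]] by simp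
next
  case top
  have inside: "\<omega> u < a" if "0 \<le> u" for u
    using inside_before_exit[OF that, of 0 a \<omega>] top by simp
  then have Xa: "X_infinity \<omega> = a" using hits by auto
  have "eventually (\<lambda>u. \<omega> u \<le> a) at_top"
    using inside by (intro eventually_mono[OF eventually_ge_at_top[of 0]]) (simp add: less_imp_le)
  then have sup: "Limsup at_top \<omega> \<le> a" by (rule Limsup_bounded)
  then have "Limsup at_top \<omega> \<noteq> \<infinity>" using a by (auto simp: top_unique)
  then have "ennsqrt (Limsup at_top \<omega> * Liminf at_top \<omega>) = a" using Xa by (simp add: X_infinity_def)
  then have prod: "Limsup at_top \<omega> * Liminf at_top \<omega> = a * a" using a by (intro ennsqrt_eqD) auto
  have ge: "a \<le> Liminf at_top \<omega>"
  proof (rule ccontr)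
    assume "\<not> ?thesis"
    then have "Liminf at_top \<omega> < a" by simp
    then have "a * Liminf at_top \<omega> < a * a" using a by (intro ennreal_mult_strict_left_mono) auto
    moreover have "Limsup at_top \<omega> * Liminf at_top \<omega> \<le> a * Liminf at_top \<omega>"
      using sup by (intro mult_right_mono) auto
    ultimately show False using prod by simp
  qed
  have r: "filterlim (\<lambda>n. enn2real (\<sigma> n)) at_top sequentially"
    unfolding filterlim_at_top
  proof
    fix Z :: real
    have "eventually (\<lambda>n. ennreal Z < \<sigma> n) sequentially"
      using \<sigma>(1) by (rule order_tendstoD) simp
    then show "eventually (\<lambda>n. Z \<le> enn2real (\<sigma> n)) sequentially"
    proof (rule eventually_mono)
      fix n assume Z: "ennreal Z < \<sigma> n"
      show "Z \<le> enn2real (\<sigma> n)"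
      proof (rule ccontr)
        assume "\<not> ?thesis"
        then have "ennreal (enn2real (\<sigma> n)) \<le> ennreal Z" by (intro ennreal_leI) simp
        with Z show False using \<sigma>(2)[of n] by simp
      qed
    qed
  qed
  have "X (min (\<sigma> n) (exit_time 0 a \<omega>)) \<omega> = \<omega> (enn2real (\<sigma> n))" for n
    using \<sigma>(2)[of n] top by (simp add: min_def X_fin)
  moreover have "a \<le> liminf (\<lambda>n. \<omega> (enn2real (\<sigma> n)))"
    unfolding le_Liminf_iff
  proof (intro allI impI)
    fix y assume "y < a"
    then have "eventually (\<lambda>u. y < \<omega> u) at_top" using ge by (simp add: le_Liminf_iff)
    then show "eventually (\<lambda>n. y < \<omega> (enn2real (\<sigma> n))) sequentially"
      using r by (rule eventually_compose_filterlim)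
  qed
  ultimately show ?thesis by simp
qed

lemma X_infinity_0_gets_small:
  assumes "X_infinity \<omega> = 0" "0 < l"
  shows "\<exists>t\<ge>0. \<omega> t < l"
proof (rule ccontr)
  assume "\<not> ?thesis"
  then have "eventually (\<lambda>t. l \<le> \<omega> t) at_top"
    by (intro eventually_mono[OF eventually_ge_at_top[of 0]]) (simp add: not_less)
  then have inf: "l \<le> Liminf at_top \<omega>" by (rule Liminf_bounded)
  moreover have "Liminf at_top \<omega> \<le> Limsup at_top \<omega>" by (rule Liminf_le_Limsup) simp
  ultimately show False using assms by (auto simp: X_infinity_def split: if_splits)
qed

text \<open>Neither a finite visit to \<open>0\<close> nor the convergence of \<open>\<omega>\<close> is known here, only that \<open>\<omega>\<close> comes below \<open>l\<close>
  at some time. Since \<open>\<omega>\<close> misses \<open>a\<close>, it leaves \<open>(l, a)\<close> through the lower end, and is stopped there.\<close>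
lemma limsup_stopped_le:
  assumes \<omega>: "\<omega> \<in> C_abs" "\<forall>t\<ge>0. \<omega> t < \<infinity>" "\<omega> 0 < a"
    and l: "0 < l"
    and misses: "\<not> (\<exists>t\<ge>0. \<omega> t = a)" "X_infinity \<omega> = 0"
    and \<sigma>: "\<sigma> \<longlonglongrightarrow> \<infinity>"
  shows "limsup (\<lambda>n. X (min (\<sigma> n) (exit_time l a \<omega>)) \<omega>) \<le> l"
proof -
  have below: "\<omega> t < a" if t: "0 \<le> t" for t
  proof (rule ccontr)
    assume "\<not> ?thesis"
    then have le: "a \<le> \<omega> t" by simp
    have "connected (\<omega> ` {0..t})"
      using \<omega> t by (intro connected_continuous_image path_continuous_on) auto
    from connectedD_interval[OF this, of "\<omega> 0" "\<omega> t" a] t le \<omega>(3)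
    have "a \<in> \<omega> ` {0..t}" by (simp add: less_imp_le)
    with misses show False by auto
  qed
  from X_infinity_0_gets_small[OF misses(2) l] obtain u where u: "0 \<le> u" "\<omega> u < l" by auto
  then have "\<not> ennreal u < exit_time l a \<omega>" using inside_before_exit[of u l a \<omega>] by auto
  then obtain t where t: "exit_time l a \<omega> = ennreal t" "0 \<le> t"
    by (cases "exit_time l a \<omega>") auto
  have "\<omega> t \<le> l" using outside_at_exit[OF \<omega>(1) t(2,1)] below[OF t(2)] by auto
  then show ?thesis using lim_imp_Limsup[OF _ stopped_at_finite_exit[OF \<sigma> t]] by simp
qed

section \<open>The conditional measure\<close>

theorem lemma2p1:
  fixes P :: "(real \<Rightarrow> ennreal) measure" and a :: ennreal
  assumes "prob_space P"
    and "sets P = sets path_algebra"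
    and "nn_local_martingale P nat_filtration X"
    and "\<P>(\<omega> in P. X 0 \<omega> = 1) = 1"
    and "1 < a" and "a < \<infinity>"
    and "\<P>(\<omega> in P. min (hit a \<omega>) (hit 0 \<omega>) < top.Top) = 1"
  shows "{\<omega> \<in> space P. hit a \<omega> \<le> hit 0 \<omega>} \<in> sets P
    \<and> \<P>(\<omega> in P. hit a \<omega> \<le> hit 0 \<omega>) > 0
    \<and> value_at X (hit a) \<in> borel_measurable P
    \<and> uniform_measure P {\<omega> \<in> space P. hit a \<omega> \<le> hit 0 \<omega>} = density P (value_at X (hit a))"
proof -
  interpret prob_space P by fact
  note sets_P = assms(2) and a = assms(5,6)
  have a0: "0 < a" "a \<noteq> 0" using a(1) by (auto intro: order.strict_trans[of 0 1 a])
  have space_P: "space P = C_abs" using sets_eq_imp_space_eq[OF sets_P] by simp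
  define A where "A = {\<omega> \<in> space P. hit a \<omega> \<le> hit 0 \<omega>}"
  have A [measurable]: "A \<in> sets P"
    using hit_le_hit_0_measurable[OF a0(2) a(2)] by (simp add: A_def sets_P space_P)
  have val [measurable]: "value_at X (hit a) \<in> borel_measurable P"
    using value_at_hit_measurable[OF a(2)] by (simp add: measurable_cong_sets[OF sets_P refl])
  \<comment> \<open>Sets that are not measurable have measure \<open>0\<close>, so probability \<open>1\<close> includes measurability.\<close>
  have AE_of_prob: "AE \<omega> in P. Q \<omega>" if "\<P>(\<omega> in P. Q \<omega>) = 1" for Q
  proof -
    have "{\<omega> \<in> space P. Q \<omega>} \<in> sets P" using that measure_notin_sets by fastforce
    then show ?thesis using that prob_Collect_eq_1 by blast
  qed
  have start: "AE \<omega> in P. \<omega> 0 = 1" using AE_of_prob[OF assms(4)] by (simp add: X_def)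
  note hit = AE_of_prob[OF assms(7)]
  from assms(3) obtain \<tau> :: "nat \<Rightarrow> (real \<Rightarrow> ennreal) \<Rightarrow> ennreal"
    where \<tau>: "AE \<omega> in P. (\<lambda>n. \<tau> n \<omega>) \<longlonglongrightarrow> \<infinity>"
      and mart: "\<And>n. nn_martingale P nat_filtration (stopped X (\<lambda>\<omega>. top.Value (\<tau> n \<omega>)))"
    unfolding nn_local_martingale_def by blast
  have fin: "AE \<omega> in P. \<forall>t\<ge>0. \<omega> t < \<infinity>"
    by (rule AE_finite_paths[OF assms(1,2) mart start \<tau>])
  \<comment> \<open>The index is shifted because the grids of \<open>exit_sampling\<close> need a positive horizon.\<close>
  define \<sigma> where "\<sigma> n \<omega> = min (of_nat (Suc n)) (\<tau> (Suc n) \<omega>)" for n \<omega>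
  have \<sigma>_fin: "\<sigma> n \<omega> < \<infinity>" for n \<omega>
    unfolding \<sigma>_def by (rule min.strict_coboundedI1) (simp add: ennreal_of_nat_eq_real_of_nat del: of_nat_Suc)
  have \<sigma>: "(\<lambda>n. \<sigma> n \<omega>) \<longlonglongrightarrow> \<infinity>" if "(\<lambda>n. \<tau> n \<omega>) \<longlonglongrightarrow> \<infinity>" for \<omega>
  proof -
    have "(\<lambda>n. min (of_nat (Suc n)) (\<tau> (Suc n) \<omega>)) \<longlonglongrightarrow> min \<top> \<infinity>"
      using that by (intro tendsto_min LIMSEQ_Suc of_nat_tendsto_top_ennreal) auto
    then show ?thesis by (simp add: \<sigma>_def)
  qed
  define good where "good l n w \<longleftrightarrow> w \<in> borel_measurable P \<and> (\<integral>\<^sup>+\<omega>. w \<omega> \<partial>P) = 1 \<and>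
    (AE \<omega> in P. w \<omega> = X (min (\<sigma> n \<omega>) (exit_time l a \<omega>)) \<omega> \<and> w \<omega> \<le> a)" for l n w
  have "\<exists>w. good l n w" for l n
    using exit_sampling[OF assms(1,2) mart start fin a, of "Suc n" "Suc n" l]
    unfolding good_def \<sigma>_def by blast
  then obtain W where "\<And>l n. good l n (W l n)" by metis
  then have W [measurable]: "W l n \<in> borel_measurable P"
    and W1: "(\<integral>\<^sup>+\<omega>. W l n \<omega> \<partial>P) = 1"
    and AE_W: "AE \<omega> in P. W l n \<omega> = X (min (\<sigma> n \<omega>) (exit_time l a \<omega>)) \<omega> \<and> W l n \<omega> \<le> a" for l n
    unfolding good_def by blast+
  have AE_W': "AE \<omega> in P. \<forall>n. W l n \<omega> = X (min (\<sigma> n \<omega>) (exit_time l a \<omega>)) \<omega> \<and> W l n \<omega> \<le> a" for l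
    using AE_W by (simp add: AE_all_countable)
  \<comment> \<open>No lower barrier: Fatou's lemma bounds the mass of \<open>A\<close> from above.\<close>
  have le1: "a * emeasure P A \<le> 1"
  proof -
    have "AE \<omega> in P. a * indicator A \<omega> \<le> liminf (\<lambda>n. W 0 n \<omega>)"
      using AE_space AE_W'[of 0] hit \<tau>
    proof eventually_elim
      case (elim \<omega>)
      then show ?case
        using liminf_stopped_ge[OF _ a0(1) a(2) hit_le_hit_0_cases(1)[OF _ a0(2)] \<sigma> \<sigma>_fin, of \<omega>]
        by (auto simp: A_def space_P indicator_def)
    qed
    then have "(\<integral>\<^sup>+\<omega>. a * indicator A \<omega> \<partial>P) \<le> (\<integral>\<^sup>+\<omega>. liminf (\<lambda>n. W 0 n \<omega>) \<partial>P)"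
      by (rule nn_integral_mono_AE)
    also have "\<dots> \<le> liminf (\<lambda>n. \<integral>\<^sup>+\<omega>. W 0 n \<omega> \<partial>P)" by (intro nn_integral_liminf) simp
    finally show ?thesis by (simp add: nn_integral_cmult_indicator W1 Liminf_const)
  qed
  \<comment> \<open>A positive lower barrier \<open>l\<close> and the reverse Fatou lemma bound it from below.\<close>
  have ge: "1 \<le> a * emeasure P A + l" if l: "0 < l" for l
  proof -
    have "limsup (\<lambda>n. \<integral>\<^sup>+\<omega>. W l n \<omega> \<partial>P) \<le> (\<integral>\<^sup>+\<omega>. limsup (\<lambda>n. W l n \<omega>) \<partial>P)"
    proof (rule nn_integral_limsup[where w = "\<lambda>_. a"])
      show "(\<integral>\<^sup>+\<omega>. a \<partial>P) < \<infinity>" using a(2) by (simp add: emeasure_space_1)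
    qed (use AE_W in \<open>auto elim: eventually_mono\<close>)
    also have "AE \<omega> in P. limsup (\<lambda>n. W l n \<omega>) \<le> a * indicator A \<omega> + l"
      using AE_space AE_W'[of l] hit \<tau> fin start
    proof eventually_elim
      case (elim \<omega>)
      show ?case
      proof (cases "\<omega> \<in> A")
        case True
        have "limsup (\<lambda>n. W l n \<omega>) \<le> a" using elim(2) by (intro Limsup_bounded always_eventually) blast
        with True show ?thesis by (simp add: add_increasing2)
      next
        case False
        with elim have "\<not> hit a \<omega> \<le> hit 0 \<omega>" "\<omega> \<in> C_abs" by (auto simp: A_def space_P)
        with limsup_stopped_le[OF _ _ _ l, of \<omega> a] hit_le_hit_0_cases(2)[OF _ a0(2), of \<omega>] elim \<sigma> a(1) False
        show ?thesis by simp
      qed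
    qed
    then have "(\<integral>\<^sup>+\<omega>. limsup (\<lambda>n. W l n \<omega>) \<partial>P) \<le> (\<integral>\<^sup>+\<omega>. a * indicator A \<omega> + l \<partial>P)"
      by (rule nn_integral_mono_AE)
    also have "\<dots> = a * emeasure P A + l"
      by (simp add: nn_integral_add nn_integral_cmult_indicator emeasure_space_1)
    finally show ?thesis by (simp add: W1 Limsup_const)
  qed
  \<comment> \<open>The lower barrier \<open>l\<close> was arbitrary.\<close>
  have "1 \<le> a * emeasure P A"
    by (rule ennreal_le_epsilon) (use ge in auto)
  with le1 have p: "a * emeasure P A = 1" by (rule antisym)
  then have p0: "emeasure P A \<noteq> 0" by auto
  \<comment> \<open>Hence the normalizing constant of the conditional measure is the value of \<open>X\<close> at the hitting time of \<open>a\<close>.\<close>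
  have inv: "1 / emeasure P A = a"
    using p0 by (metis p ennreal_mult_divide_eq emeasure_finite infinity_ennreal_def)
  have "uniform_measure P A = density P (value_at X (hit a))"
    unfolding uniform_measure_def
  proof (rule density_cong)
    show "AE \<omega> in P. indicator A \<omega> / emeasure P A = value_at X (hit a) \<omega>"
      using AE_space hit
    proof eventually_elim
      case (elim \<omega>)
      then show ?case
        using value_at_hit_eq_indicator[of \<omega> a] a0 a inv by (auto simp: A_def space_P indicator_def)
    qed
  qed measurable
  moreover have "prob A > 0"
    using p0 by (simp add: emeasure_eq_measure zero_less_measure_iff)
  ultimately show ?thesis using A val unfolding A_def by simp
qed

end
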